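(* For any types $A, B : \Box_i$, there is an equivalence of types \[(A \simeq B) \;\simeq\; \Sigma R : A \to B \to \Box_i.\ \mathrm{isUMap}(R) \times \mathrm{isUMap}(R^{-1}),\] where $R^{-1} : B \to A \to \Box_i$ is $R^{-1}\,b\,a := R\,a\,b$.
   Context: The ambient setting is dependent type theory in the style of the Homotopy Type Theory book (dependent functions $\Pi$, dependent pairs $\Sigma$, the identity type $=$, function extensionality), with universes $\Box_i$. $X \simeq Y$ is the usual (HoTT-book) type of equivalences $\Sigma f : X \to Y.\,\mathrm{isEquiv}(f)$. For $f,g : X \to Y$, $f \doteqdot g := \Pi x.\, f\,x = g\,x$. For $R : A \to B \to \Box_i$, $\mathrm{isUMap}(R)$ is the type $\Sigma (m : A \to B).\,\Sigma (g_1 : \Pi a\,b.\, m\,a = b \to R\,a\,b).\,\Sigma (g_2 : \Pi a\,b.\, R\,a\,b \to m\,a = b).\,\Pi a\,b.\,(g_1\,a\,b)\circ(g_2\,a\,b) \doteqdot id$.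
   Formalization: The type theory is taken with the univalence axiom in addition to function extensionality; without univalence the claim fails, e.g. in the set model with A = B = 1, where the right-hand side has one element per singleton type in the universe. *)

theory Defs
  imports Main
begin

text \<open>
  Intensional dependent type theory as presented in the appendix of the Homotopy Type Theory
  book, restricted to the type formers \<open>\<Pi>\<close>, \<open>\<Sigma>\<close>, identity types and a cumulative hierarchy of
  universes, with the function extensionality and univalence axioms.  It is embedded deeply: an
  assertion ``there is an element of the type \<open>T\<close>'' becomes the existence of a term \<open>t\<close> such that
  \<open>t \<^bold>: T\<close> is derivable.  A shallow embedding with families of types as HOL functions is not
  possible, because HOL families can separate points joined by a path, contradicting univalence.
\<close>

section \<open>Syntax\<close>

text \<open>
  Variables are de Bruijn indices.  Binding structure: the second argument of \<open>PiT\<close>, \<open>SigT\<close> and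
  \<open>Lam\<close> binds one variable.  In \<open>SigInd A B C g p\<close>, \<open>B\<close> and \<open>C\<close> bind one variable and \<open>g\<close> binds two;
  in \<open>IdInd A C c a b p\<close>, \<open>C\<close> binds three variables and \<open>c\<close> binds one; in \<open>Funext A B f g\<close>, \<open>B\<close>
  binds one variable.
\<close>

datatype tm =
    Var nat
  | Univ nat
  | PiT tm tm
  | Lam tm tm
  | App tm tm
  | SigT tm tm
  | Pair tm tm
  | SigInd tm tm tm tm tm
  | IdT tm tm tm
  | Refl tm
  | IdInd tm tm tm tm tm tm
  | Funext tm tm tm tm
  | Univalence nat tm tm

definition up_ren :: "(nat \<Rightarrow> nat) \<Rightarrow> nat \<Rightarrow> nat" where
  "up_ren \<xi> = case_nat 0 (\<lambda>n. Suc (\<xi> n))"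

primrec ren :: "(nat \<Rightarrow> nat) \<Rightarrow> tm \<Rightarrow> tm" where
  "ren \<xi> (Var n) = Var (\<xi> n)"
| "ren \<xi> (Univ i) = Univ i"
| "ren \<xi> (PiT A B) = PiT (ren \<xi> A) (ren (up_ren \<xi>) B)"
| "ren \<xi> (Lam A b) = Lam (ren \<xi> A) (ren (up_ren \<xi>) b)"
| "ren \<xi> (App f a) = App (ren \<xi> f) (ren \<xi> a)"
| "ren \<xi> (SigT A B) = SigT (ren \<xi> A) (ren (up_ren \<xi>) B)"
| "ren \<xi> (Pair a b) = Pair (ren \<xi> a) (ren \<xi> b)"
| "ren \<xi> (SigInd A B C g p) =
     SigInd (ren \<xi> A) (ren (up_ren \<xi>) B) (ren (up_ren \<xi>) C) (ren (up_ren (up_ren \<xi>)) g) (ren \<xi> p)"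
| "ren \<xi> (IdT A a b) = IdT (ren \<xi> A) (ren \<xi> a) (ren \<xi> b)"
| "ren \<xi> (Refl a) = Refl (ren \<xi> a)"
| "ren \<xi> (IdInd A C c a b p) =
     IdInd (ren \<xi> A) (ren (up_ren (up_ren (up_ren \<xi>))) C) (ren (up_ren \<xi>) c)
       (ren \<xi> a) (ren \<xi> b) (ren \<xi> p)"
| "ren \<xi> (Funext A B f g) = Funext (ren \<xi> A) (ren (up_ren \<xi>) B) (ren \<xi> f) (ren \<xi> g)"
| "ren \<xi> (Univalence i A B) = Univalence i (ren \<xi> A) (ren \<xi> B)"

definition wk :: "nat \<Rightarrow> tm \<Rightarrow> tm" where
  "wk k = ren (\<lambda>n. n + k)"

definition scons :: "tm \<Rightarrow> (nat \<Rightarrow> tm) \<Rightarrow> nat \<Rightarrow> tm" (infixr \<open>\<cdot>\<close> 65) where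
  "t \<cdot> \<sigma> = case_nat t \<sigma>"

definition up :: "(nat \<Rightarrow> tm) \<Rightarrow> nat \<Rightarrow> tm" where
  "up \<sigma> = Var 0 \<cdot> (\<lambda>n. wk 1 (\<sigma> n))"

primrec subst :: "(nat \<Rightarrow> tm) \<Rightarrow> tm \<Rightarrow> tm" where
  "subst \<sigma> (Var n) = \<sigma> n"
| "subst \<sigma> (Univ i) = Univ i"
| "subst \<sigma> (PiT A B) = PiT (subst \<sigma> A) (subst (up \<sigma>) B)"
| "subst \<sigma> (Lam A b) = Lam (subst \<sigma> A) (subst (up \<sigma>) b)"
| "subst \<sigma> (App f a) = App (subst \<sigma> f) (subst \<sigma> a)"
| "subst \<sigma> (SigT A B) = SigT (subst \<sigma> A) (subst (up \<sigma>) B)"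
| "subst \<sigma> (Pair a b) = Pair (subst \<sigma> a) (subst \<sigma> b)"
| "subst \<sigma> (SigInd A B C g p) =
     SigInd (subst \<sigma> A) (subst (up \<sigma>) B) (subst (up \<sigma>) C) (subst (up (up \<sigma>)) g) (subst \<sigma> p)"
| "subst \<sigma> (IdT A a b) = IdT (subst \<sigma> A) (subst \<sigma> a) (subst \<sigma> b)"
| "subst \<sigma> (Refl a) = Refl (subst \<sigma> a)"
| "subst \<sigma> (IdInd A C c a b p) =
     IdInd (subst \<sigma> A) (subst (up (up (up \<sigma>))) C) (subst (up \<sigma>) c)
       (subst \<sigma> a) (subst \<sigma> b) (subst \<sigma> p)"
| "subst \<sigma> (Funext A B f g) = Funext (subst \<sigma> A) (subst (up \<sigma>) B) (subst \<sigma> f) (subst \<sigma> g)"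
| "subst \<sigma> (Univalence i A B) = Univalence i (subst \<sigma> A) (subst \<sigma> B)"

definition inst :: "tm \<Rightarrow> tm \<Rightarrow> tm" where
  "inst b a = subst (a \<cdot> Var) b"

section \<open>Equivalences\<close>

definition arrow :: "tm \<Rightarrow> tm \<Rightarrow> tm" where
  "arrow A B = PiT A (wk 1 B)"

definition product :: "tm \<Rightarrow> tm \<Rightarrow> tm" where
  "product A B = SigT A (wk 1 B)"

definition idfun :: "tm \<Rightarrow> tm" where
  "idfun A = Lam A (Var 0)"

text \<open>The composite \<open>g \<circ> f\<close>, where \<open>A\<close> is the domain of \<open>f\<close>.\<close>

definition composite :: "tm \<Rightarrow> tm \<Rightarrow> tm \<Rightarrow> tm" where
  "composite A g f = Lam A (App (wk 1 g) (App (wk 1 f) (Var 0)))"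

text \<open>The type \<open>\<Pi>x : A. f x = g x\<close> for \<open>f, g : A \<rightarrow> B\<close>.\<close>

definition homotopy :: "tm \<Rightarrow> tm \<Rightarrow> tm \<Rightarrow> tm \<Rightarrow> tm" where
  "homotopy A B f g = PiT A (IdT (wk 1 B) (App (wk 1 f) (Var 0)) (App (wk 1 g) (Var 0)))"

text \<open>
  \<open>isEquiv f\<close> for \<open>f : A \<rightarrow> B\<close> is
  \<open>(\<Sigma>g : B \<rightarrow> A. f \<circ> g \<sim> id) \<times> (\<Sigma>h : B \<rightarrow> A. h \<circ> f \<sim> id)\<close>.
\<close>

definition isEquiv :: "tm \<Rightarrow> tm \<Rightarrow> tm \<Rightarrow> tm" where
  "isEquiv A B f =
     product
       (SigT (arrow B A)
          (homotopy (wk 1 B) (wk 1 B) (composite (wk 1 B) (wk 1 f) (Var 0)) (idfun (wk 1 B))))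
       (SigT (arrow B A)
          (homotopy (wk 1 A) (wk 1 A) (composite (wk 1 A) (Var 0) (wk 1 f)) (idfun (wk 1 A))))"

definition Equiv :: "tm \<Rightarrow> tm \<Rightarrow> tm" where
  "Equiv A B = SigT (arrow A B) (isEquiv (wk 1 A) (wk 1 B) (Var 0))"

definition id_equiv :: "tm \<Rightarrow> tm" where
  "id_equiv A =
     Pair (idfun A)
       (Pair (Pair (idfun A) (Lam A (Refl (Var 0)))) (Pair (idfun A) (Lam A (Refl (Var 0)))))"

text \<open>The canonical map \<open>(f = g) \<rightarrow> (\<Pi>x : A. f x = g x)\<close> for \<open>f, g : \<Pi>x : A. B\<close>.\<close>

definition happly :: "tm \<Rightarrow> tm \<Rightarrow> tm \<Rightarrow> tm \<Rightarrow> tm" where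
  "happly A B f g =
     Lam (IdT (PiT A B) f g)
       (IdInd (wk 1 (PiT A B))
          (PiT (wk 4 A)
             (IdT (ren (up_ren (\<lambda>n. n + 4)) B) (App (Var 3) (Var 0)) (App (Var 2) (Var 0))))
          (Lam (wk 2 A) (Refl (App (Var 1) (Var 0))))
          (wk 1 f) (wk 1 g) (Var 0))"

text \<open>The canonical map \<open>(A = B) \<rightarrow> (A \<simeq> B)\<close> for \<open>A\<close>, \<open>B\<close> in the \<open>i\<close>-th universe.\<close>

definition idtoeqv :: "nat \<Rightarrow> tm \<Rightarrow> tm \<Rightarrow> tm" where
  "idtoeqv i A B =
     Lam (IdT (Univ i) A B)
       (IdInd (Univ i) (Equiv (Var 2) (Var 1)) (id_equiv (Var 0)) (wk 1 A) (wk 1 B) (Var 0))"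

section \<open>Judgements\<close>

text \<open>
  The head of a context is the most recently declared variable, and an entry may depend on the
  entries behind it in the list.  Weakening and substitution are admissible and hence not
  primitive.
\<close>

inductive wf_ctx :: "tm list \<Rightarrow> bool"
  and has_type :: "tm list \<Rightarrow> tm \<Rightarrow> tm \<Rightarrow> bool" (\<open>_ \<turnstile> _ \<^bold>: _\<close> [51, 51, 51] 50)
  and eq_type :: "tm list \<Rightarrow> tm \<Rightarrow> tm \<Rightarrow> tm \<Rightarrow> bool" (\<open>_ \<turnstile> _ \<approx> _ \<^bold>: _\<close> [51, 51, 51, 51] 50)
where
  ctx_empty: "wf_ctx []"
| ctx_ext: "\<Gamma> \<turnstile> A \<^bold>: Univ i \<Longrightarrow> wf_ctx (A # \<Gamma>)"

| ty_var: "wf_ctx \<Gamma> \<Longrightarrow> k < length \<Gamma> \<Longrightarrow> \<Gamma> \<turnstile> Var k \<^bold>: wk (Suc k) (\<Gamma> ! k)"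
| ty_conv: "\<Gamma> \<turnstile> a \<^bold>: A \<Longrightarrow> \<Gamma> \<turnstile> A \<approx> B \<^bold>: Univ i \<Longrightarrow> \<Gamma> \<turnstile> a \<^bold>: B"

| ty_univ: "wf_ctx \<Gamma> \<Longrightarrow> \<Gamma> \<turnstile> Univ i \<^bold>: Univ (Suc i)"
| ty_cumul: "\<Gamma> \<turnstile> A \<^bold>: Univ i \<Longrightarrow> \<Gamma> \<turnstile> A \<^bold>: Univ (Suc i)"

| ty_pi: "\<Gamma> \<turnstile> A \<^bold>: Univ i \<Longrightarrow> A # \<Gamma> \<turnstile> B \<^bold>: Univ i \<Longrightarrow> \<Gamma> \<turnstile> PiT A B \<^bold>: Univ i"
| ty_lam: "A # \<Gamma> \<turnstile> b \<^bold>: B \<Longrightarrow> \<Gamma> \<turnstile> Lam A b \<^bold>: PiT A B"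
| ty_app: "\<Gamma> \<turnstile> f \<^bold>: PiT A B \<Longrightarrow> \<Gamma> \<turnstile> a \<^bold>: A \<Longrightarrow> \<Gamma> \<turnstile> App f a \<^bold>: inst B a"

| ty_sig: "\<Gamma> \<turnstile> A \<^bold>: Univ i \<Longrightarrow> A # \<Gamma> \<turnstile> B \<^bold>: Univ i \<Longrightarrow> \<Gamma> \<turnstile> SigT A B \<^bold>: Univ i"
| ty_pair: "A # \<Gamma> \<turnstile> B \<^bold>: Univ i \<Longrightarrow> \<Gamma> \<turnstile> a \<^bold>: A \<Longrightarrow> \<Gamma> \<turnstile> b \<^bold>: inst B a \<Longrightarrow>
    \<Gamma> \<turnstile> Pair a b \<^bold>: SigT A B"
| ty_sigind: "SigT A B # \<Gamma> \<turnstile> C \<^bold>: Univ i \<Longrightarrow>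
    B # A # \<Gamma> \<turnstile> g \<^bold>: subst (Pair (Var 1) (Var 0) \<cdot> (\<lambda>n. Var (n + 2))) C \<Longrightarrow>
    \<Gamma> \<turnstile> p \<^bold>: SigT A B \<Longrightarrow>
    \<Gamma> \<turnstile> SigInd A B C g p \<^bold>: inst C p"

| ty_id: "\<Gamma> \<turnstile> A \<^bold>: Univ i \<Longrightarrow> \<Gamma> \<turnstile> a \<^bold>: A \<Longrightarrow> \<Gamma> \<turnstile> b \<^bold>: A \<Longrightarrow> \<Gamma> \<turnstile> IdT A a b \<^bold>: Univ i"
| ty_refl: "\<Gamma> \<turnstile> A \<^bold>: Univ i \<Longrightarrow> \<Gamma> \<turnstile> a \<^bold>: A \<Longrightarrow> \<Gamma> \<turnstile> Refl a \<^bold>: IdT A a a"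
| ty_idind: "IdT (wk 2 A) (Var 1) (Var 0) # wk 1 A # A # \<Gamma> \<turnstile> C \<^bold>: Univ i \<Longrightarrow>
    A # \<Gamma> \<turnstile> c \<^bold>: subst (Refl (Var 0) \<cdot> Var 0 \<cdot> Var 0 \<cdot> (\<lambda>n. Var (n + 1))) C \<Longrightarrow>
    \<Gamma> \<turnstile> a \<^bold>: A \<Longrightarrow> \<Gamma> \<turnstile> b \<^bold>: A \<Longrightarrow> \<Gamma> \<turnstile> p \<^bold>: IdT A a b \<Longrightarrow>
    \<Gamma> \<turnstile> IdInd A C c a b p \<^bold>: subst (p \<cdot> b \<cdot> a \<cdot> Var) C"

| ty_funext: "\<Gamma> \<turnstile> f \<^bold>: PiT A B \<Longrightarrow> \<Gamma> \<turnstile> g \<^bold>: PiT A B \<Longrightarrow>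
    \<Gamma> \<turnstile> Funext A B f g \<^bold>:
      isEquiv (IdT (PiT A B) f g) (PiT A (IdT B (App (wk 1 f) (Var 0)) (App (wk 1 g) (Var 0))))
        (happly A B f g)"
| ty_univalence: "\<Gamma> \<turnstile> A \<^bold>: Univ i \<Longrightarrow> \<Gamma> \<turnstile> B \<^bold>: Univ i \<Longrightarrow>
    \<Gamma> \<turnstile> Univalence i A B \<^bold>: isEquiv (IdT (Univ i) A B) (Equiv A B) (idtoeqv i A B)"

| eq_refl: "\<Gamma> \<turnstile> a \<^bold>: A \<Longrightarrow> \<Gamma> \<turnstile> a \<approx> a \<^bold>: A"
| eq_sym: "\<Gamma> \<turnstile> a \<approx> b \<^bold>: A \<Longrightarrow> \<Gamma> \<turnstile> b \<approx> a \<^bold>: A"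
| eq_trans: "\<Gamma> \<turnstile> a \<approx> b \<^bold>: A \<Longrightarrow> \<Gamma> \<turnstile> b \<approx> c \<^bold>: A \<Longrightarrow> \<Gamma> \<turnstile> a \<approx> c \<^bold>: A"
| eq_conv: "\<Gamma> \<turnstile> a \<approx> b \<^bold>: A \<Longrightarrow> \<Gamma> \<turnstile> A \<approx> B \<^bold>: Univ i \<Longrightarrow> \<Gamma> \<turnstile> a \<approx> b \<^bold>: B"
| eq_cumul: "\<Gamma> \<turnstile> A \<approx> B \<^bold>: Univ i \<Longrightarrow> \<Gamma> \<turnstile> A \<approx> B \<^bold>: Univ (Suc i)"

| eq_beta: "A # \<Gamma> \<turnstile> b \<^bold>: B \<Longrightarrow> \<Gamma> \<turnstile> a \<^bold>: A \<Longrightarrow> \<Gamma> \<turnstile> App (Lam A b) a \<approx> inst b a \<^bold>: inst B a"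
| eq_eta: "\<Gamma> \<turnstile> f \<^bold>: PiT A B \<Longrightarrow> \<Gamma> \<turnstile> f \<approx> Lam A (App (wk 1 f) (Var 0)) \<^bold>: PiT A B"
| eq_sigind_beta: "SigT A B # \<Gamma> \<turnstile> C \<^bold>: Univ i \<Longrightarrow>
    B # A # \<Gamma> \<turnstile> g \<^bold>: subst (Pair (Var 1) (Var 0) \<cdot> (\<lambda>n. Var (n + 2))) C \<Longrightarrow>
    \<Gamma> \<turnstile> a \<^bold>: A \<Longrightarrow> \<Gamma> \<turnstile> b \<^bold>: inst B a \<Longrightarrow>
    \<Gamma> \<turnstile> SigInd A B C g (Pair a b) \<approx> subst (b \<cdot> a \<cdot> Var) g \<^bold>: inst C (Pair a b)"
| eq_idind_beta: "IdT (wk 2 A) (Var 1) (Var 0) # wk 1 A # A # \<Gamma> \<turnstile> C \<^bold>: Univ i \<Longrightarrow>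
    A # \<Gamma> \<turnstile> c \<^bold>: subst (Refl (Var 0) \<cdot> Var 0 \<cdot> Var 0 \<cdot> (\<lambda>n. Var (n + 1))) C \<Longrightarrow>
    \<Gamma> \<turnstile> a \<^bold>: A \<Longrightarrow>
    \<Gamma> \<turnstile> IdInd A C c a a (Refl a) \<approx> inst c a \<^bold>: subst (Refl a \<cdot> a \<cdot> a \<cdot> Var) C"

| eq_pi: "\<Gamma> \<turnstile> A \<approx> A' \<^bold>: Univ i \<Longrightarrow> A # \<Gamma> \<turnstile> B \<approx> B' \<^bold>: Univ i \<Longrightarrow>
    \<Gamma> \<turnstile> PiT A B \<approx> PiT A' B' \<^bold>: Univ i"
| eq_lam: "\<Gamma> \<turnstile> A \<approx> A' \<^bold>: Univ i \<Longrightarrow> A # \<Gamma> \<turnstile> b \<approx> b' \<^bold>: B \<Longrightarrow>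
    \<Gamma> \<turnstile> Lam A b \<approx> Lam A' b' \<^bold>: PiT A B"
| eq_app: "\<Gamma> \<turnstile> f \<approx> f' \<^bold>: PiT A B \<Longrightarrow> \<Gamma> \<turnstile> a \<approx> a' \<^bold>: A \<Longrightarrow>
    \<Gamma> \<turnstile> App f a \<approx> App f' a' \<^bold>: inst B a"
| eq_sig: "\<Gamma> \<turnstile> A \<approx> A' \<^bold>: Univ i \<Longrightarrow> A # \<Gamma> \<turnstile> B \<approx> B' \<^bold>: Univ i \<Longrightarrow>
    \<Gamma> \<turnstile> SigT A B \<approx> SigT A' B' \<^bold>: Univ i"
| eq_pair: "A # \<Gamma> \<turnstile> B \<^bold>: Univ i \<Longrightarrow> \<Gamma> \<turnstile> a \<approx> a' \<^bold>: A \<Longrightarrow> \<Gamma> \<turnstile> b \<approx> b' \<^bold>: inst B a \<Longrightarrow>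
    \<Gamma> \<turnstile> Pair a b \<approx> Pair a' b' \<^bold>: SigT A B"
| eq_sigind: "\<Gamma> \<turnstile> A \<approx> A' \<^bold>: Univ i \<Longrightarrow> A # \<Gamma> \<turnstile> B \<approx> B' \<^bold>: Univ i \<Longrightarrow>
    SigT A B # \<Gamma> \<turnstile> C \<approx> C' \<^bold>: Univ j \<Longrightarrow>
    B # A # \<Gamma> \<turnstile> g \<approx> g' \<^bold>: subst (Pair (Var 1) (Var 0) \<cdot> (\<lambda>n. Var (n + 2))) C \<Longrightarrow>
    \<Gamma> \<turnstile> p \<approx> p' \<^bold>: SigT A B \<Longrightarrow>
    \<Gamma> \<turnstile> SigInd A B C g p \<approx> SigInd A' B' C' g' p' \<^bold>: inst C p"
| eq_id: "\<Gamma> \<turnstile> A \<approx> A' \<^bold>: Univ i \<Longrightarrow> \<Gamma> \<turnstile> a \<approx> a' \<^bold>: A \<Longrightarrow> \<Gamma> \<turnstile> b \<approx> b' \<^bold>: A \<Longrightarrow>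
    \<Gamma> \<turnstile> IdT A a b \<approx> IdT A' a' b' \<^bold>: Univ i"
| eq_reflexivity: "\<Gamma> \<turnstile> A \<^bold>: Univ i \<Longrightarrow> \<Gamma> \<turnstile> a \<approx> a' \<^bold>: A \<Longrightarrow>
    \<Gamma> \<turnstile> Refl a \<approx> Refl a' \<^bold>: IdT A a a"
| eq_idind: "\<Gamma> \<turnstile> A \<approx> A' \<^bold>: Univ i \<Longrightarrow>
    IdT (wk 2 A) (Var 1) (Var 0) # wk 1 A # A # \<Gamma> \<turnstile> C \<approx> C' \<^bold>: Univ j \<Longrightarrow>
    A # \<Gamma> \<turnstile> c \<approx> c' \<^bold>: subst (Refl (Var 0) \<cdot> Var 0 \<cdot> Var 0 \<cdot> (\<lambda>n. Var (n + 1))) C \<Longrightarrow>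
    \<Gamma> \<turnstile> a \<approx> a' \<^bold>: A \<Longrightarrow> \<Gamma> \<turnstile> b \<approx> b' \<^bold>: A \<Longrightarrow> \<Gamma> \<turnstile> p \<approx> p' \<^bold>: IdT A a b \<Longrightarrow>
    \<Gamma> \<turnstile> IdInd A C c a b p \<approx> IdInd A' C' c' a' b' p' \<^bold>: subst (p \<cdot> b \<cdot> a \<cdot> Var) C"
| eq_funext: "\<Gamma> \<turnstile> A \<approx> A' \<^bold>: Univ i \<Longrightarrow> A # \<Gamma> \<turnstile> B \<approx> B' \<^bold>: Univ i \<Longrightarrow>
    \<Gamma> \<turnstile> f \<approx> f' \<^bold>: PiT A B \<Longrightarrow> \<Gamma> \<turnstile> g \<approx> g' \<^bold>: PiT A B \<Longrightarrow>
    \<Gamma> \<turnstile> Funext A B f g \<approx> Funext A' B' f' g' \<^bold>: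
      isEquiv (IdT (PiT A B) f g) (PiT A (IdT B (App (wk 1 f) (Var 0)) (App (wk 1 g) (Var 0))))
        (happly A B f g)"
| eq_univalence: "\<Gamma> \<turnstile> A \<approx> A' \<^bold>: Univ i \<Longrightarrow> \<Gamma> \<turnstile> B \<approx> B' \<^bold>: Univ i \<Longrightarrow>
    \<Gamma> \<turnstile> Univalence i A B \<approx> Univalence i A' B' \<^bold>:
      isEquiv (IdT (Univ i) A B) (Equiv A B) (idtoeqv i A B)"

section \<open>Univalent maps\<close>

text \<open>
  For \<open>R : A \<rightarrow> B \<rightarrow> Univ i\<close>, the type
  \<open>\<Sigma>m : A \<rightarrow> B. \<Sigma>g\<^sub>1 : (\<Pi>a b. m a = b \<rightarrow> R a b). \<Sigma>g\<^sub>2 : (\<Pi>a b. R a b \<rightarrow> m a = b).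
    \<Pi>a b. g\<^sub>1 a b \<circ> g\<^sub>2 a b \<sim> id\<close>.
  Under the binders of \<open>a\<close> and \<open>b\<close> these two are \<open>Var 1\<close> and \<open>Var 0\<close>, and the components
  already introduced start at \<open>Var 2\<close>, the latest first.
\<close>

definition isUMap :: "tm \<Rightarrow> tm \<Rightarrow> tm \<Rightarrow> tm" where
  "isUMap A B R =
     SigT (arrow A B)
       (SigT (PiT (wk 1 A) (PiT (wk 2 B)
                (arrow (IdT (wk 3 B) (App (Var 2) (Var 1)) (Var 0))
                       (App (App (wk 3 R) (Var 1)) (Var 0)))))
         (SigT (PiT (wk 2 A) (PiT (wk 3 B)
                  (arrow (App (App (wk 4 R) (Var 1)) (Var 0))
                         (IdT (wk 4 B) (App (Var 3) (Var 1)) (Var 0)))))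
           (PiT (wk 3 A) (PiT (wk 4 B)
             (let Rab = App (App (wk 5 R) (Var 1)) (Var 0);
                  g1ab = App (App (Var 3) (Var 1)) (Var 0);
                  g2ab = App (App (Var 2) (Var 1)) (Var 0)
              in homotopy Rab Rab (composite Rab g1ab g2ab) (idfun Rab))))))"

text \<open>The converse \<open>\<lambda>b a. R a b\<close> of \<open>R : A \<rightarrow> B \<rightarrow> Univ i\<close>.\<close>

definition converse_rel :: "tm \<Rightarrow> tm \<Rightarrow> tm \<Rightarrow> tm" where
  "converse_rel A B R = Lam B (Lam (wk 1 A) (App (App (wk 2 R) (Var 0)) (Var 1)))"

text \<open>The type \<open>\<Sigma>R : A \<rightarrow> B \<rightarrow> Univ i. isUMap R \<times> isUMap (\<lambda>b a. R a b)\<close>.\<close>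

definition UMapRel :: "nat \<Rightarrow> tm \<Rightarrow> tm \<Rightarrow> tm" where
  "UMapRel i A B =
     SigT (arrow A (arrow B (Univ i)))
       (product (isUMap (wk 1 A) (wk 1 B) (Var 0))
                (isUMap (wk 1 B) (wk 1 A) (converse_rel (wk 1 A) (wk 1 B) (Var 0))))"

end

theory Submission
  imports Defs "HOL-Library.Monad_Syntax"
begin

text \<open>
  For a univalent map \<open>R\<close> with function \<open>m\<close>, each \<open>R a b\<close> is a retract of \<open>m a = b\<close>, and retracts of a
  based path space \<open>\<lambda>b. m a = b\<close> are equivalent to it; by univalence and function extensionality \<open>R\<close>
  is the graph of \<open>m\<close>.  The univalent map structures on a graph are all equal, by induction on
  homotopies, so \<open>isUMap R\<close> is a proposition for every \<open>R\<close>.  Being an equivalence is a proposition as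
  well, because by univalence only identity functions have to be considered.  Since a function is
  an equivalence iff the converse of its graph is a univalent map, both sides of the theorem consist
  of functions subject to equivalent propositions.

  Proof terms are certified by a normalising type checker written and verified in HOL, and executed
  by the simplifier.
\<close>

section \<open>A normalising type checker\<close>

text \<open>\<open>isUMap\<close> asks for one composite only, and this asymmetry makes it a
  proposition. On the graph of \<open>m\<close>, a map \<open>g1\<close> for a function
  \<open>n\<close> amounts by path induction to a homotopy from \<open>m\<close> to
  \<open>n\<close>, so the pair of \<open>n\<close> and \<open>g1\<close> is contractible; once
  \<open>g1\<close> is the identity, \<open>g2\<close> and the law form a homotopy to the identity,
  again a contractible choice. A second composite would add a free family of homotopies. One
  composite still gives an equivalence between \<open>R a b\<close> and \<open>m a = b\<close>: an
  endomap of a family of based path spaces is composition with a fixed path, so \<open>g2\<close>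
  after \<open>g1\<close> is invertible. Both propositionality claims assume an element first. It
  moves the claim to a graph or to an identity function, where contractibility can be shown
  directly. Relations into \<open>univ i\<close> live at level \<open>Suc i\<close>, so the general
  lemmas are stated there and smaller types enter by cumulativity; univalence is applied only inside
  \<open>univ i\<close>.\<close>

fun dest_univ :: "tm \<times> tm \<Rightarrow> (tm \<times> nat) option" where
  "dest_univ (A, Univ i) = Some (A, i)"
| "dest_univ _ = None"

fun dest_type :: "tm \<times> tm \<Rightarrow> tm option" where
  "dest_type (A, Univ i) = Some A"
| "dest_type _ = None"

fun dest_pi :: "tm \<Rightarrow> (tm \<times> tm) option" where
  "dest_pi (PiT A B) = Some (A, B)"
| "dest_pi _ = None"

definition guard :: "bool \<Rightarrow> unit option" where
  "guard b = (if b then Some () else None)"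

fun lookup :: "tm list \<Rightarrow> nat \<Rightarrow> tm option" where
  "lookup (A # \<Gamma>) 0 = Some A"
| "lookup (A # \<Gamma>) (Suc k) = lookup \<Gamma> k"
| "lookup [] _ = None"

definition var_type :: "tm list \<Rightarrow> nat \<Rightarrow> tm option" where
  "var_type \<Gamma> k = lookup \<Gamma> k \<bind> (\<lambda>A. Some (wk (Suc k) A))"

fun lam_body :: "tm \<Rightarrow> tm option" where
  "lam_body (Lam A b) = Some b"
| "lam_body _ = None"

fun pair_subst :: "tm \<Rightarrow> (nat \<Rightarrow> tm) option" where
  "pair_subst (Pair a b) = Some (b \<cdot> a \<cdot> Var)"
| "pair_subst _ = None"

fun refl_arg :: "tm \<Rightarrow> tm option" where
  "refl_arg (Refl a) = Some a"
| "refl_arg _ = None"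

text \<open>Substituting a neutral term into a normal type creates no redex, so an instantiated type
  is normalised again only for terms of these forms. This saves work; soundness does not depend on
  it.\<close>

fun intro :: "tm \<Rightarrow> bool" where
  "intro (Lam A b) = True"
| "intro (Pair a b) = True"
| "intro (Refl a) = True"
| "intro _ = False"

text \<open>
  Pairs and reflexivity carry no type annotation, so a redex whose function ends in one of them has
  no inferable type.
\<close>

fun check_only :: "tm \<Rightarrow> bool" where
  "check_only (Pair a b) = True"
| "check_only (Refl a) = True"
| "check_only (Lam A b) = check_only b"
| "check_only (App f a) = check_only f"
| "check_only _ = False"

definition unannotated :: "tm \<Rightarrow> (tm \<times> nat) option" where
  "unannotated t = (case t of
     App f a \<Rightarrow> (case a of Var k \<Rightarrow> if check_only f then Some (f, k) else None | _ \<Rightarrow> None)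
   | _ \<Rightarrow> None)"

definition subtype :: "tm \<Rightarrow> tm \<Rightarrow> bool" where
  "subtype S T \<longleftrightarrow> S = T \<or> (\<exists>i j. S = Univ i \<and> T = Univ j \<and> i \<le> j)"

text \<open>
  The head \<open>f\<close> of an eta redex body \<open>App (wk 1 f) (Var 0)\<close>.  Instantiating \<open>Var 0\<close> strips the weakening,
  and re-weakening detects whether \<open>Var 0\<close> occurred.
\<close>

definition eta_head :: "tm \<Rightarrow> tm option" where
  "eta_head b = (case b of
     App g x \<Rightarrow> if x = Var 0 \<and> wk 1 (inst g (Var 0)) = g then Some (inst g (Var 0)) else None
   | _ \<Rightarrow> None)"

text \<open>
  \<open>nf m \<Gamma> t\<close> returns a normal form of \<open>t\<close> together with its type, which is inferred if \<open>m = None\<close> and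
  must be \<open>T\<close> if \<open>m = Some T\<close>.  Contexts and types are kept normal, so that conversion is syntactic
  equality.  After each contraction the contractum is checked again from scratch: this makes the
  soundness proof independent of subject reduction and of the injectivity of \<open>\<Pi>\<close>.  In the last case
  the type of \<open>f\<close> is guessed by abstracting the variable \<open>k\<close> from \<open>T\<close>.
\<close>

(* The body of nf exceeds the default search bound of unification. *)
declare [[unify_search_bound = 500]]

partial_function (option) nf :: "tm option \<Rightarrow> tm list \<Rightarrow> tm \<Rightarrow> (tm \<times> tm) option" where
  "nf m \<Gamma> t = (case m of
     None \<Rightarrow> (case t of
       Var k \<Rightarrow> do {
         A \<leftarrow> var_type \<Gamma> k;
         Some (Var k, A) }
     | Univ i \<Rightarrow> Some (Univ i, Univ (Suc i))
     | PiT A B \<Rightarrow> do {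
         (A, i) \<leftarrow> nf None \<Gamma> A \<bind> dest_univ;
         (B, j) \<leftarrow> nf None (A # \<Gamma>) B \<bind> dest_univ;
         l \<leftarrow> Some (max i j);
         Some (PiT A B, Univ l) }
     | SigT A B \<Rightarrow> do {
         (A, i) \<leftarrow> nf None \<Gamma> A \<bind> dest_univ;
         (B, j) \<leftarrow> nf None (A # \<Gamma>) B \<bind> dest_univ;
         l \<leftarrow> Some (max i j);
         Some (SigT A B, Univ l) }
     | IdT A a b \<Rightarrow> do {
         (A, i) \<leftarrow> nf None \<Gamma> A \<bind> dest_univ;
         (a, _) \<leftarrow> nf (Some A) \<Gamma> a;
         (b, _) \<leftarrow> nf (Some A) \<Gamma> b;
         Some (IdT A a b, Univ i) }
     | Lam A b \<Rightarrow> do {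
         (A, i) \<leftarrow> nf None \<Gamma> A \<bind> dest_univ;
         (b, B) \<leftarrow> nf None (A # \<Gamma>) b;
         (case eta_head b of
            None \<Rightarrow> Some (Lam A b, PiT A B)
          | Some f \<Rightarrow> do {
              r \<leftarrow> nf None \<Gamma> f;
              Some (if r = (f, PiT A B) then r else (Lam A b, PiT A B)) }) }
     | App f a \<Rightarrow> do {
         (f, F) \<leftarrow> nf None \<Gamma> f;
         (A, B) \<leftarrow> dest_pi F;
         (a, _) \<leftarrow> nf (Some A) \<Gamma> a;
         T \<leftarrow> Some (inst B a);
         T \<leftarrow> (if intro a then nf None \<Gamma> T \<bind> dest_type else Some T);
         (case lam_body f of
            None \<Rightarrow> Some (App f a, T)
          | Some b \<Rightarrow> Some (inst b a) \<bind> nf (Some T) \<Gamma>) }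
     | SigInd A B C g p \<Rightarrow> do {
         (A, i) \<leftarrow> nf None \<Gamma> A \<bind> dest_univ;
         (B, j) \<leftarrow> nf None (A # \<Gamma>) B \<bind> dest_univ;
         (C, k) \<leftarrow> nf None (SigT A B # \<Gamma>) C \<bind> dest_univ;
         G \<leftarrow> Some (subst (Pair (Var 1) (Var 0) \<cdot> (\<lambda>n. Var (n + 2))) C);
         (G, l) \<leftarrow> nf None (B # A # \<Gamma>) G \<bind> dest_univ;
         (g, _) \<leftarrow> nf (Some G) (B # A # \<Gamma>) g;
         (p, _) \<leftarrow> nf (Some (SigT A B)) \<Gamma> p;
         T \<leftarrow> Some (inst C p);
         T \<leftarrow> (if intro p then nf None \<Gamma> T \<bind> dest_type else Some T);
         (case pair_subst p of
            None \<Rightarrow> Some (SigInd A B C g p, T)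
          | Some \<sigma> \<Rightarrow> Some (subst \<sigma> g) \<bind> nf (Some T) \<Gamma>) }
     | IdInd A C c a b p \<Rightarrow> do {
         (A, i) \<leftarrow> nf None \<Gamma> A \<bind> dest_univ;
         X \<leftarrow> Some (wk 1 A);
         Y \<leftarrow> Some (IdT (wk 2 A) (Var 1) (Var 0));
         (X', j) \<leftarrow> nf None (A # \<Gamma>) X \<bind> dest_univ;
         guard (X' = X);
         (Y', k) \<leftarrow> nf None (X # A # \<Gamma>) Y \<bind> dest_univ;
         guard (Y' = Y);
         (C, l) \<leftarrow> nf None (Y # X # A # \<Gamma>) C \<bind> dest_univ;
         D \<leftarrow> Some (subst (Refl (Var 0) \<cdot> Var 0 \<cdot> Var 0 \<cdot> (\<lambda>n. Var (n + 1))) C);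
         (D, q) \<leftarrow> nf None (A # \<Gamma>) D \<bind> dest_univ;
         (c, _) \<leftarrow> nf (Some D) (A # \<Gamma>) c;
         (a, _) \<leftarrow> nf (Some A) \<Gamma> a;
         (b, _) \<leftarrow> nf (Some A) \<Gamma> b;
         (p, _) \<leftarrow> nf (Some (IdT A a b)) \<Gamma> p;
         T \<leftarrow> Some (subst (p \<cdot> b \<cdot> a \<cdot> Var) C);
         T \<leftarrow> (if intro a \<or> intro b \<or> intro p then nf None \<Gamma> T \<bind> dest_type else Some T);
         (case refl_arg p of
            None \<Rightarrow> Some (IdInd A C c a b p, T)
          | Some x \<Rightarrow> Some (inst c x) \<bind> nf (Some T) \<Gamma>) }
     | Funext A B f g \<Rightarrow> do {
         (A, i) \<leftarrow> nf None \<Gamma> A \<bind> dest_univ;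
         (B, j) \<leftarrow> nf None (A # \<Gamma>) B \<bind> dest_univ;
         (f, _) \<leftarrow> nf (Some (PiT A B)) \<Gamma> f;
         (g, _) \<leftarrow> nf (Some (PiT A B)) \<Gamma> g;
         T \<leftarrow> Some (isEquiv (IdT (PiT A B) f g)
             (PiT A (IdT B (App (wk 1 f) (Var 0)) (App (wk 1 g) (Var 0)))) (happly A B f g));
         (T, r) \<leftarrow> nf None \<Gamma> T \<bind> dest_univ;
         Some (Funext A B f g, T) }
     | Univalence u A B \<Rightarrow> do {
         (A, _) \<leftarrow> nf (Some (Univ u)) \<Gamma> A;
         (B, _) \<leftarrow> nf (Some (Univ u)) \<Gamma> B;
         T \<leftarrow> Some (isEquiv (IdT (Univ u) A B) (Equiv A B) (idtoeqv u A B));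
         (T, r) \<leftarrow> nf None \<Gamma> T \<bind> dest_univ;
         Some (Univalence u A B, T) }
     | _ \<Rightarrow> None)
   | Some T \<Rightarrow> (case t of
       Lam A b \<Rightarrow> (case T of PiT A\<^sub>1 B \<Rightarrow> do {
         (A, i) \<leftarrow> nf None \<Gamma> A \<bind> dest_univ;
         guard (A = A\<^sub>1);
         (b, _) \<leftarrow> nf (Some B) (A # \<Gamma>) b;
         (case eta_head b of
            None \<Rightarrow> Some (Lam A b, PiT A B)
          | Some f \<Rightarrow> do {
              r \<leftarrow> nf None \<Gamma> f;
              Some (if r = (f, PiT A B) then r else (Lam A b, PiT A B)) }) }
         | _ \<Rightarrow> None)
     | Pair a b \<Rightarrow> (case T of SigT A B \<Rightarrow> do {
         (A\<^sub>1, i) \<leftarrow> nf None \<Gamma> A \<bind> dest_univ;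
         (B\<^sub>1, j) \<leftarrow> nf None (A\<^sub>1 # \<Gamma>) B \<bind> dest_univ;
         guard (A\<^sub>1 = A);
         guard (B\<^sub>1 = B);
         (a, _) \<leftarrow> nf (Some A) \<Gamma> a;
         S \<leftarrow> Some (inst B a);
         S \<leftarrow> (if intro a then nf None \<Gamma> S \<bind> dest_type else Some S);
         (b, _) \<leftarrow> nf (Some S) \<Gamma> b;
         Some (Pair a b, SigT A B) }
         | _ \<Rightarrow> None)
     | Refl a \<Rightarrow> (case T of IdT A x y \<Rightarrow> do {
         (A\<^sub>1, i) \<leftarrow> nf None \<Gamma> A \<bind> dest_univ;
         guard (A\<^sub>1 = A);
         (a, _) \<leftarrow> nf (Some A) \<Gamma> a;
         guard (x = a);
         guard (y = a);
         Some (Refl a, IdT A a a) }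
         | _ \<Rightarrow> None)
     | _ \<Rightarrow> (case unannotated t of
         None \<Rightarrow> do {
           (t, S) \<leftarrow> nf None \<Gamma> t;
           guard (subtype S T);
           Some (t, T) }
       | Some (f, k) \<Rightarrow> do {
           A \<leftarrow> var_type \<Gamma> k;
           B \<leftarrow> Some (ren (\<lambda>n. if n = k then 0 else Suc n) T);
           guard (inst B (Var k) = T);
           (f, _) \<leftarrow> nf (Some (PiT A B)) \<Gamma> f;
           (case lam_body f of
              None \<Rightarrow> Some (App f (Var k), T)
            | Some b \<Rightarrow> Some (inst b (Var k)) \<bind> nf (Some T) \<Gamma>) })))"

section \<open>Soundness of the checker\<close>

text \<open>Inversion of typing for the introduction forms, carried along as part of the invariant.
  The computation rules need the components typed at exactly the displayed type, and recovering this
  from a derivation that ends in a conversion would require injectivity of Pi.\<close>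

definition canonical :: "tm list \<Rightarrow> tm \<Rightarrow> tm \<Rightarrow> bool" where
  "canonical \<Gamma> t T \<longleftrightarrow> (case t of
     Lam A b \<Rightarrow> \<exists>B. T = PiT A B \<and> A # \<Gamma> \<turnstile> b \<^bold>: B
   | Pair a b \<Rightarrow> \<exists>A B. T = SigT A B \<and> \<Gamma> \<turnstile> a \<^bold>: A \<and> \<Gamma> \<turnstile> b \<^bold>: inst B a
   | Refl a \<Rightarrow> \<exists>A. T = IdT A a a \<and> \<Gamma> \<turnstile> a \<^bold>: A
   | _ \<Rightarrow> True)"

text \<open>The normal form stands on the left of the equation because the congruence rules build
  contexts and types from their left components, and the checker keeps those normal.\<close>

definition sound :: "tm list \<Rightarrow> tm \<Rightarrow> tm \<Rightarrow> tm \<Rightarrow> bool" where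
  "sound \<Gamma> t t' T \<longleftrightarrow> \<Gamma> \<turnstile> t' \<^bold>: T \<and> \<Gamma> \<turnstile> t' \<approx> t \<^bold>: T \<and> canonical \<Gamma> t' T"

lemma dest_univ_Some [simp]: "dest_univ r = Some (A, i) \<longleftrightarrow> r = (A, Univ i)"
  by (cases r rule: dest_univ.cases) auto

lemma dest_type_Some [simp]: "dest_type r = Some A \<longleftrightarrow> (\<exists>i. r = (A, Univ i))"
  by (cases r rule: dest_type.cases) auto

lemma dest_pi_Some [simp]: "dest_pi F = Some (A, B) \<longleftrightarrow> F = PiT A B"
  by (cases F) auto

lemma guard_Some [simp]: "guard b = Some u \<longleftrightarrow> b"
  by (simp add: guard_def)

lemma lookup_Some: "lookup \<Gamma> k = Some A \<longleftrightarrow> k < length \<Gamma> \<and> A = \<Gamma> ! k"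
  by (induction \<Gamma> k rule: lookup.induct) auto

lemma var_type_Some [simp]: "var_type \<Gamma> k = Some A \<longleftrightarrow> k < length \<Gamma> \<and> A = wk (Suc k) (\<Gamma> ! k)"
  by (auto simp: var_type_def Option.bind_eq_Some_conv lookup_Some)

lemma lam_body_Some: "lam_body t = Some b \<longleftrightarrow> (\<exists>A. t = Lam A b)"
  by (cases t) auto

lemma pair_subst_Some: "pair_subst t = Some \<sigma> \<longleftrightarrow> (\<exists>a b. t = Pair a b \<and> \<sigma> = b \<cdot> a \<cdot> Var)"
  by (cases t) auto

lemma refl_arg_Some: "refl_arg t = Some a \<longleftrightarrow> t = Refl a"
  by (cases t) auto

lemma unannotated_Some: "unannotated t = Some (f, k) \<longleftrightarrow> t = App f (Var k) \<and> check_only f"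
  by (auto simp: unannotated_def split: tm.splits)

lemma eta_head_Some: "eta_head b = Some f \<Longrightarrow> b = App (wk 1 f) (Var 0)"
  by (auto simp: eta_head_def  split: tm.splits if_splits)

lemma cumul_le:
  assumes "i \<le> j"
  shows "\<Gamma> \<turnstile> A \<^bold>: Univ i \<Longrightarrow> \<Gamma> \<turnstile> A \<^bold>: Univ j"
    and "\<Gamma> \<turnstile> A \<approx> B \<^bold>: Univ i \<Longrightarrow> \<Gamma> \<turnstile> A \<approx> B \<^bold>: Univ j"
  using assms by (induction j rule: dec_induct) (auto intro: ty_cumul eq_cumul)

lemma soundI:
  "\<Gamma> \<turnstile> t' \<^bold>: T \<Longrightarrow> \<Gamma> \<turnstile> t' \<approx> t \<^bold>: T \<Longrightarrow> canonical \<Gamma> t' T \<Longrightarrow> sound \<Gamma> t t' T"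
  by (simp add: sound_def)

lemma sound_refl: "\<Gamma> \<turnstile> t \<^bold>: T \<Longrightarrow> canonical \<Gamma> t T \<Longrightarrow> sound \<Gamma> t t T"
  by (rule soundI[OF _ wf_ctx_has_type_eq_type.eq_refl])

lemma soundD:
  assumes "sound \<Gamma> t t' T"
  shows "\<Gamma> \<turnstile> t' \<^bold>: T" and "\<Gamma> \<turnstile> t' \<approx> t \<^bold>: T" and "canonical \<Gamma> t' T"
  using assms by (simp_all add: sound_def)

text \<open>Reflexivity of the equality judgement would demand that the type is itself typed, which
  for an instantiated family needs a substitution lemma. Syntactic equality is therefore a separate
  disjunct.\<close>

definition conv :: "tm list \<Rightarrow> tm \<Rightarrow> tm \<Rightarrow> bool" where
  "conv \<Gamma> S T \<longleftrightarrow> S = T \<or> (\<exists>i. \<Gamma> \<turnstile> S \<approx> T \<^bold>: Univ i)"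

lemma conv_sym: "conv \<Gamma> S T \<Longrightarrow> conv \<Gamma> T S"
  by (auto simp: conv_def intro: eq_sym)

lemma conv_ty: "\<Gamma> \<turnstile> t \<^bold>: S \<Longrightarrow> conv \<Gamma> S T \<Longrightarrow> \<Gamma> \<turnstile> t \<^bold>: T"
  by (auto simp: conv_def intro: ty_conv)

lemma conv_eq: "\<Gamma> \<turnstile> t \<approx> u \<^bold>: S \<Longrightarrow> conv \<Gamma> S T \<Longrightarrow> \<Gamma> \<turnstile> t \<approx> u \<^bold>: T"
  by (auto simp: conv_def intro: eq_conv)

lemma sound_conv: "sound \<Gamma> S T (Univ i) \<Longrightarrow> conv \<Gamma> T S"
  by (auto simp: conv_def sound_def)

lemma sound_trans: "sound \<Gamma> u t' T \<Longrightarrow> \<Gamma> \<turnstile> u \<approx> t \<^bold>: T \<Longrightarrow> sound \<Gamma> t t' T"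
  by (auto simp: sound_def intro: eq_trans)

lemma sound_subtype:
  assumes "sound \<Gamma> t t' S" and "subtype S T"
  shows "sound \<Gamma> t t' T"
proof (cases "S = T")
  case False
  then obtain i j where [simp]: "S = Univ i" "T = Univ j" and "i \<le> j"
    using assms(2) by (auto simp: subtype_def)
  with assms(1) show ?thesis
    by (auto simp: sound_def canonical_def split: tm.splits intro: cumul_le)
qed (use assms in simp)

section \<open>Soundness of each term former and its computation rule\<close>

lemma sound_App:
  assumes f: "sound \<Gamma> f f' (PiT A B)" and a: "sound \<Gamma> a a' A" and T: "conv \<Gamma> (inst B a') T"
  shows "sound \<Gamma> (App f a) (App f' a') T"
    and "f' = Lam A' b \<Longrightarrow> sound \<Gamma> (inst b a') r T \<Longrightarrow> sound \<Gamma> (App f a) r T"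
proof -
  note f = soundD[OF f] and a = soundD[OF a]
  have eq: "\<Gamma> \<turnstile> App f' a' \<approx> App f a \<^bold>: T"
    by (rule conv_eq[OF eq_app T]) (use f a in simp_all)
  show "sound \<Gamma> (App f a) (App f' a') T"
    by (rule soundI[OF conv_ty[OF ty_app T] eq]) (use f a in \<open>simp_all add: canonical_def\<close>)
  assume f': "f' = Lam A' b" and r: "sound \<Gamma> (inst b a') r T"
  have "A # \<Gamma> \<turnstile> b \<^bold>: B" "A' = A"
    using f f' by (auto simp: canonical_def)
  then have "\<Gamma> \<turnstile> App f' a' \<approx> inst b a' \<^bold>: T"
    using f' a by (auto intro: conv_eq[OF eq_beta T])
  then have "\<Gamma> \<turnstile> inst b a' \<approx> App f a \<^bold>: T"
    by (rule eq_trans[OF eq_sym eq])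
  then show "sound \<Gamma> (App f a) r T"
    by (rule sound_trans[OF r])
qed

lemma sound_Lam:
  assumes A: "sound \<Gamma> A A' (Univ i)" and b: "sound (A' # \<Gamma>) b b' B"
  shows "sound \<Gamma> (Lam A b) (Lam A' b') (PiT A' B)"
    and "b' = App (wk 1 f) (Var 0) \<Longrightarrow> sound \<Gamma> f f (PiT A' B) \<Longrightarrow> sound \<Gamma> (Lam A b) f (PiT A' B)"
proof -
  note A = soundD[OF A] and b = soundD[OF b]
  have eq: "\<Gamma> \<turnstile> Lam A' b' \<approx> Lam A b \<^bold>: PiT A' B"
    using A b by (auto intro: eq_lam)
  show "sound \<Gamma> (Lam A b) (Lam A' b') (PiT A' B)"
    using A b eq by (auto intro!: soundI ty_lam simp: canonical_def)
  assume b': "b' = App (wk 1 f) (Var 0)" and f: "sound \<Gamma> f f (PiT A' B)"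
  have "\<Gamma> \<turnstile> f \<approx> Lam A b \<^bold>: PiT A' B"
    using eq_trans[OF eq_eta[OF soundD(1)[OF f]]] eq b' by simp
  then show "sound \<Gamma> (Lam A b) f (PiT A' B)"
    by (rule sound_trans[OF f])
qed

lemma sound_SigInd:
  assumes A: "sound \<Gamma> A A' (Univ i)" and B: "sound (A' # \<Gamma>) B B' (Univ j)"
    and C: "sound (SigT A' B' # \<Gamma>) C C' (Univ k)"
    and G: "conv (B' # A' # \<Gamma>) (subst (Pair (Var 1) (Var 0) \<cdot> (\<lambda>n. Var (n + 2))) C') G"
    and g: "sound (B' # A' # \<Gamma>) g g' G" and p: "sound \<Gamma> p p' (SigT A' B')"
    and T: "conv \<Gamma> (inst C' p') T"
  shows "sound \<Gamma> (SigInd A B C g p) (SigInd A' B' C' g' p') T"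
    and "p' = Pair a b \<Longrightarrow> sound \<Gamma> (subst (b \<cdot> a \<cdot> Var) g') r T \<Longrightarrow> sound \<Gamma> (SigInd A B C g p) r T"
proof -
  \<comment> \<open>\<open>eq_sigind\<close> wants \<open>A\<close> and \<open>B\<close> at a common
    level, so both are lifted to the maximum.\<close>
  have A: "\<Gamma> \<turnstile> A' \<approx> A \<^bold>: Univ (max i j)" and B: "A' # \<Gamma> \<turnstile> B' \<approx> B \<^bold>: Univ (max i j)"
    using soundD(2)[OF A] soundD(2)[OF B]
    by (auto intro: cumul_le(2)[of i "max i j"] cumul_le(2)[of j "max i j"])
  note C = soundD[OF C] and p = soundD[OF p]
  have g: "B' # A' # \<Gamma> \<turnstile> g' \<^bold>: subst (Pair (Var 1) (Var 0) \<cdot> (\<lambda>n. Var (n + 2))) C'"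
    "B' # A' # \<Gamma> \<turnstile> g' \<approx> g \<^bold>: subst (Pair (Var 1) (Var 0) \<cdot> (\<lambda>n. Var (n + 2))) C'"
    using soundD(1)[OF g] soundD(2)[OF g] conv_sym[OF G] by (auto intro: conv_ty conv_eq)
  have eq: "\<Gamma> \<turnstile> SigInd A' B' C' g' p' \<approx> SigInd A B C g p \<^bold>: T"
    by (rule conv_eq[OF eq_sigind T]) (use A B C g p in simp_all)
  show "sound \<Gamma> (SigInd A B C g p) (SigInd A' B' C' g' p') T"
    by (rule soundI[OF conv_ty[OF ty_sigind T] eq]) (use C g p in \<open>simp_all add: canonical_def\<close>)
  assume p': "p' = Pair a b" and r: "sound \<Gamma> (subst (b \<cdot> a \<cdot> Var) g') r T"
  have "\<Gamma> \<turnstile> a \<^bold>: A'" "\<Gamma> \<turnstile> b \<^bold>: inst B' a"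
    using p p' by (auto simp: canonical_def)
  then have "\<Gamma> \<turnstile> SigInd A' B' C' g' p' \<approx> subst (b \<cdot> a \<cdot> Var) g' \<^bold>: T"
    using C g T unfolding p' by (intro conv_eq[OF eq_sigind_beta]) auto
  then have "\<Gamma> \<turnstile> subst (b \<cdot> a \<cdot> Var) g' \<approx> SigInd A B C g p \<^bold>: T"
    by (rule eq_trans[OF eq_sym eq])
  then show "sound \<Gamma> (SigInd A B C g p) r T"
    by (rule sound_trans[OF r])
qed

lemma sound_IdInd:
  assumes A: "sound \<Gamma> A A' (Univ i)"
    and C: "sound (IdT (wk 2 A') (Var 1) (Var 0) # wk 1 A' # A' # \<Gamma>) C C' (Univ k)"
    and D: "conv (A' # \<Gamma>) (subst (Refl (Var 0) \<cdot> Var 0 \<cdot> Var 0 \<cdot> (\<lambda>n. Var (n + 1))) C') D"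
    and c: "sound (A' # \<Gamma>) c c' D" and a: "sound \<Gamma> a a' A'" and b: "sound \<Gamma> b b' A'"
    and p: "sound \<Gamma> p p' (IdT A' a' b')"
    and T: "conv \<Gamma> (subst (p' \<cdot> b' \<cdot> a' \<cdot> Var) C') T"
  shows "sound \<Gamma> (IdInd A C c a b p) (IdInd A' C' c' a' b' p') T"
    and "p' = Refl x \<Longrightarrow> sound \<Gamma> (inst c' x) r T \<Longrightarrow> sound \<Gamma> (IdInd A C c a b p) r T"
proof -
  note A = soundD[OF A] and C = soundD[OF C] and a = soundD[OF a] and b = soundD[OF b] and p = soundD[OF p]
  have c: "A' # \<Gamma> \<turnstile> c' \<^bold>: subst (Refl (Var 0) \<cdot> Var 0 \<cdot> Var 0 \<cdot> (\<lambda>n. Var (n + 1))) C'"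
    "A' # \<Gamma> \<turnstile> c' \<approx> c \<^bold>: subst (Refl (Var 0) \<cdot> Var 0 \<cdot> Var 0 \<cdot> (\<lambda>n. Var (n + 1))) C'"
    using soundD(1)[OF c] soundD(2)[OF c] conv_sym[OF D] by (auto intro: conv_ty conv_eq)
  have eq: "\<Gamma> \<turnstile> IdInd A' C' c' a' b' p' \<approx> IdInd A C c a b p \<^bold>: T"
    by (rule conv_eq[OF eq_idind T]) (use A C c a b p in simp_all)
  show "sound \<Gamma> (IdInd A C c a b p) (IdInd A' C' c' a' b' p') T"
    by (rule soundI[OF conv_ty[OF ty_idind T] eq]) (use C c a b p in \<open>simp_all add: canonical_def\<close>)
  assume p': "p' = Refl x" and r: "sound \<Gamma> (inst c' x) r T"
  have x: "a' = x" "b' = x" and "\<Gamma> \<turnstile> x \<^bold>: A'"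
    using p p' by (auto simp: canonical_def)
  then have "\<Gamma> \<turnstile> IdInd A' C' c' a' b' p' \<approx> inst c' x \<^bold>: T"
    using C c T unfolding p' x by (intro conv_eq[OF eq_idind_beta]) auto
  then have "\<Gamma> \<turnstile> inst c' x \<approx> IdInd A C c a b p \<^bold>: T"
    by (rule eq_trans[OF eq_sym eq])
  then show "sound \<Gamma> (IdInd A C c a b p) r T"
    by (rule sound_trans[OF r])
qed

lemma sound_binder:
  assumes A: "sound \<Gamma> A A' (Univ i)" and B: "sound (A' # \<Gamma>) B B' (Univ j)"
  shows "sound \<Gamma> (PiT A B) (PiT A' B') (Univ (max i j))"
    and "sound \<Gamma> (SigT A B) (SigT A' B') (Univ (max i j))"
proof -
  have "\<Gamma> \<turnstile> A' \<approx> A \<^bold>: Univ (max i j)" "A' # \<Gamma> \<turnstile> B' \<approx> B \<^bold>: Univ (max i j)"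
    "\<Gamma> \<turnstile> A' \<^bold>: Univ (max i j)" "A' # \<Gamma> \<turnstile> B' \<^bold>: Univ (max i j)"
    using soundD(1,2)[OF A] soundD(1,2)[OF B]
    by (auto intro: cumul_le[of i "max i j"] cumul_le[of j "max i j"])
  then show "sound \<Gamma> (PiT A B) (PiT A' B') (Univ (max i j))"
    and "sound \<Gamma> (SigT A B) (SigT A' B') (Univ (max i j))"
    by (auto simp: sound_def canonical_def intro: ty_pi ty_sig eq_pi eq_sig)
qed

lemma sound_IdT:
  assumes "sound \<Gamma> A A' (Univ i)" "sound \<Gamma> a a' A'" "sound \<Gamma> b b' A'"
  shows "sound \<Gamma> (IdT A a b) (IdT A' a' b') (Univ i)"
  using assms by (auto simp: sound_def canonical_def intro: ty_id eq_id)

lemma sound_Pair: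
  assumes "A # \<Gamma> \<turnstile> B \<^bold>: Univ j" and "sound \<Gamma> a a' A" and S: "conv \<Gamma> (inst B a') S" and "sound \<Gamma> b b' S"
  shows "sound \<Gamma> (Pair a b) (Pair a' b') (SigT A B)"
proof -
  have "\<Gamma> \<turnstile> b' \<^bold>: inst B a'" "\<Gamma> \<turnstile> b' \<approx> b \<^bold>: inst B a'"
    using soundD(1,2)[OF assms(4)] conv_sym[OF S] by (auto intro: conv_ty conv_eq)
  then show ?thesis
    using assms by (auto simp: sound_def canonical_def intro: ty_pair eq_pair)
qed

lemma sound_Refl:
  assumes "\<Gamma> \<turnstile> A \<^bold>: Univ i" and "sound \<Gamma> a a' A"
  shows "sound \<Gamma> (Refl a) (Refl a') (IdT A a' a')"
  using assms by (auto simp: sound_def canonical_def intro: ty_refl eq_reflexivity)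

lemma sound_Funext:
  assumes "sound \<Gamma> A A' (Univ i)" "sound (A' # \<Gamma>) B B' (Univ j)"
    "sound \<Gamma> f f' (PiT A' B')" "sound \<Gamma> g g' (PiT A' B')"
    and T: "conv \<Gamma> (isEquiv (IdT (PiT A' B') f' g')
      (PiT A' (IdT B' (App (wk 1 f') (Var 0)) (App (wk 1 g') (Var 0)))) (happly A' B' f' g')) T"
  shows "sound \<Gamma> (Funext A B f g) (Funext A' B' f' g') T"
proof -
  have "\<Gamma> \<turnstile> A' \<approx> A \<^bold>: Univ (max i j)" "A' # \<Gamma> \<turnstile> B' \<approx> B \<^bold>: Univ (max i j)"
    using soundD(2)[OF assms(1)] soundD(2)[OF assms(2)]
    by (auto intro: cumul_le(2)[of i "max i j"] cumul_le(2)[of j "max i j"])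
  then show ?thesis
    using assms by (auto simp: sound_def canonical_def
        intro: conv_ty[OF ty_funext] conv_eq[OF eq_funext])
qed

lemma sound_Univalence:
  assumes "sound \<Gamma> A A' (Univ i)" "sound \<Gamma> B B' (Univ i)"
    and T: "conv \<Gamma> (isEquiv (IdT (Univ i) A' B') (Equiv A' B') (idtoeqv i A' B')) T"
  shows "sound \<Gamma> (Univalence i A B) (Univalence i A' B') T"
  using assms
  by (auto simp: sound_def canonical_def intro: conv_ty[OF ty_univalence] conv_eq[OF eq_univalence])

text \<open>Fixed-point induction: only calls that return a result have to be considered, so no
  termination argument is needed.\<close>

theorem nf_sound:
  assumes "nf m \<Gamma> t = Some (t', T)" and "wf_ctx \<Gamma>"
  shows "sound \<Gamma> t t' T \<and> (\<forall>S. m = Some S \<longrightarrow> T = S)"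
proof -
  define P where "P m \<Gamma> t r \<longleftrightarrow> (wf_ctx \<Gamma> \<longrightarrow> sound \<Gamma> t (fst r) (snd r) \<and> (\<forall>S. m = Some S \<longrightarrow> snd r = S))"
    for m \<Gamma> t and r :: "tm \<times> tm"
  have "P m \<Gamma> t r" if "nf m \<Gamma> t = Some r" for m \<Gamma> t r
    using that
  proof (rule nf.raw_induct[where P = P, rotated], goal_cases)
    \<comment> \<open>From here on \<open>nf\<close> is a bound approximation of the fixed point
      that shadows the constant. The first assumption is the claim for its results;
      \<open>inf\<close> and \<open>chk\<close> split it by mode.\<close>
    case (1 nf m \<Gamma> t r)
    have inf: "sound \<Gamma> t t' T" if "nf None \<Gamma> t = Some (t', T)" "wf_ctx \<Gamma>" for \<Gamma> t t' T
      using 1(1)[OF that(1)] that(2) by (simp add: P_def)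
    have chk: "T = S" "sound \<Gamma> t t' S" if "nf (Some S) \<Gamma> t = Some (t', T)" "wf_ctx \<Gamma>" for \<Gamma> t t' S T
      using 1(1)[OF that(1)] that(2) by (auto simp: P_def)
    have chk': "sound \<Gamma> t (fst r) S \<and> snd r = S" if "nf (Some S) \<Gamma> t = Some r" "wf_ctx \<Gamma>" for \<Gamma> t r S
      using chk[of S \<Gamma> t "fst r" "snd r"] that by (metis prod.collapse)
    have ext: "wf_ctx (A' # \<Gamma>)" if "nf None \<Gamma> A = Some (A', Univ i)" "wf_ctx \<Gamma>" for \<Gamma> A A' i
      using soundD(1)[OF inf[OF that]] by (rule ctx_ext)
    have inf_conv: "conv \<Gamma> S T" if "nf None \<Gamma> S = Some (T, Univ i)" "wf_ctx \<Gamma>" for \<Gamma> S T i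
      by (rule conv_sym[OF sound_conv[OF inf[OF that]]])
    \<comment> \<open>Covers the types that are normalised again only after the substitution of an
      introduction form.\<close>
    have if_conv: "conv \<Gamma> S T"
      if "(if b then nf None \<Gamma> S \<bind> dest_type else Some S) = Some T" "wf_ctx \<Gamma>"
      for \<Gamma> S T b
      using that
      by (auto simp: Option.bind_eq_Some_conv conv_def[of _ T T] intro: inf_conv split: if_splits)
    note bind = Option.bind_eq_Some_conv
    show ?case
    proof (cases m)
      case [simp]: None
      have "sound \<Gamma> t (fst r) (snd r)" if wf: "wf_ctx \<Gamma>"
      proof (cases t)
        case [simp]: (Var k)
        show ?thesis
          using 1(2) wf by (auto simp: bind canonical_def intro!: sound_refl ty_var)
      next
        case [simp]: (Univ i)
        show ?thesis
          using 1(2) wf by (auto simp: canonical_def intro!: sound_refl ty_univ)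
      next
        case [simp]: (PiT A B)
        show ?thesis
          using 1(2) wf by (auto simp: bind) (assumption | rule sound_binder inf ext)+

      next
        case [simp]: (SigT A B)
        show ?thesis
          using 1(2) wf by (auto simp: bind) (assumption | rule sound_binder inf ext)+
      next
        case [simp]: (IdT A a b)
        show ?thesis
          using 1(2) wf by (auto simp: bind) (assumption | rule sound_IdT inf chk(2))+
      next
        case [simp]: (Lam A b)
        obtain A' i b' B where A: "nf None \<Gamma> A = Some (A', Univ i)" and b: "nf None (A' # \<Gamma>) b = Some (b', B)"
          and r: "(case eta_head b' of None \<Rightarrow> Some (Lam A' b', PiT A' B)
             | Some f \<Rightarrow> nf None \<Gamma> f \<bind>
                 (\<lambda>r. Some (if r = (f, PiT A' B) then r else (Lam A' b', PiT A' B)))) = Some r"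
          using 1(2) by (auto simp: bind)
        note Lam = sound_Lam[OF inf[OF A wf] inf[OF b ext[OF A wf]]]
        show ?thesis
          using r Lam(1) Lam(2)[OF eta_head_Some inf[OF _ wf]]
          by (auto simp: bind split: option.splits if_splits)
      next
        case [simp]: (App f a)
        obtain f' A B a' U T where f: "nf None \<Gamma> f = Some (f', PiT A B)" and a: "nf (Some A) \<Gamma> a = Some (a', U)"
          and T: "(if intro a' then nf None \<Gamma> (inst B a') \<bind> dest_type else Some (inst B a')) = Some T"
          and r: "(case lam_body f' of None \<Rightarrow> Some (App f' a', T)
             | Some b \<Rightarrow> Some (inst b a') \<bind> nf (Some T) \<Gamma>) = Some r"
          using 1(2) by (auto simp: bind)
        note App = sound_App[OF inf[OF f wf] chk(2)[OF a wf] if_conv[OF T wf]]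
        show ?thesis
        proof (cases "lam_body f'")
          case None
          then show ?thesis
            using r App(1) by auto
        next
          case (Some b)
          then show ?thesis
            using r App(2) by (auto simp: lam_body_Some dest!: chk'[OF _ wf])
        qed
      next
        case [simp]: (SigInd A B C g p)
        obtain A' i B' j C' k G l g' U p' U' T where A: "nf None \<Gamma> A = Some (A', Univ i)"
          and B: "nf None (A' # \<Gamma>) B = Some (B', Univ j)"
          and C: "nf None (SigT A' B' # \<Gamma>) C = Some (C', Univ k)"
          and G: "nf None (B' # A' # \<Gamma>) (subst (Pair (Var 1) (Var 0) \<cdot> (\<lambda>n. Var (n + 2))) C') = Some (G, Univ l)"
          and g: "nf (Some G) (B' # A' # \<Gamma>) g = Some (g', U)"
          and p: "nf (Some (SigT A' B')) \<Gamma> p = Some (p', U')"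
          and T: "(if intro p' then nf None \<Gamma> (inst C' p') \<bind> dest_type else Some (inst C' p')) = Some T"
          and r: "(case pair_subst p' of None \<Rightarrow> Some (SigInd A' B' C' g' p', T)
             | Some \<sigma> \<Rightarrow> Some (subst \<sigma> g') \<bind> nf (Some T) \<Gamma>) = Some r"
          using 1(2) by (auto simp: bind)
        note wfA = ext[OF A wf] and wfB = ext[OF B ext[OF A wf]]
        note sA = inf[OF A wf] and sB = inf[OF B wfA]
        have wfS: "wf_ctx (SigT A' B' # \<Gamma>)"
          using soundD(1)[OF sound_binder(2)[OF sA sB]] by (rule ctx_ext)
        note SigInd = sound_SigInd[OF sA sB inf[OF C wfS] inf_conv[OF G wfB] chk(2)[OF g wfB]
            chk(2)[OF p wf] if_conv[OF T wf]]
        show ?thesis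
        proof (cases "pair_subst p'")
          case None
          then show ?thesis
            using r SigInd(1) by auto
        next
          case (Some \<sigma>)
          then show ?thesis
            using r SigInd(2) by (auto simp: pair_subst_Some dest!: chk'[OF _ wf])
        qed
      next
        case [simp]: (IdInd A C c a b p)
        let ?Y = "\<lambda>A. IdT (wk 2 A) (Var 1) (Var 0)"
        obtain A' i j k C' l D q c' U a' U1 b' U2 p' U3 T where A: "nf None \<Gamma> A = Some (A', Univ i)"
          and X: "nf None (A' # \<Gamma>) (wk 1 A') = Some (wk 1 A', Univ j)"
          and Y: "nf None (wk 1 A' # A' # \<Gamma>) (?Y A') = Some (?Y A', Univ k)"
          and C: "nf None (?Y A' # wk 1 A' # A' # \<Gamma>) C = Some (C', Univ l)"
          and D: "nf None (A' # \<Gamma>) (subst (Refl (Var 0) \<cdot> Var 0 \<cdot> Var 0 \<cdot> (\<lambda>n. Var (n + 1))) C') = Some (D, Univ q)"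
          and c: "nf (Some D) (A' # \<Gamma>) c = Some (c', U)"
          and a: "nf (Some A') \<Gamma> a = Some (a', U1)"
          and b: "nf (Some A') \<Gamma> b = Some (b', U2)"
          and p: "nf (Some (IdT A' a' b')) \<Gamma> p = Some (p', U3)"
          and T: "(if intro a' \<or> intro b' \<or> intro p' then nf None \<Gamma> (subst (p' \<cdot> b' \<cdot> a' \<cdot> Var) C') \<bind> dest_type
                else Some (subst (p' \<cdot> b' \<cdot> a' \<cdot> Var) C')) = Some T"
          and r: "(case refl_arg p' of None \<Rightarrow> Some (IdInd A' C' c' a' b' p', T)
             | Some x \<Rightarrow> Some (inst c' x) \<bind> nf (Some T) \<Gamma>) = Some r"
          using 1(2) by (auto simp: bind)
        note wfA = ext[OF A wf]
        note wfY = ext[OF Y ext[OF X wfA]]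
        note IdInd = sound_IdInd[OF inf[OF A wf] inf[OF C wfY] inf_conv[OF D wfA] chk(2)[OF c wfA]
            chk(2)[OF a wf] chk(2)[OF b wf] chk(2)[OF p wf] if_conv[OF T wf]]
        show ?thesis
        proof (cases "refl_arg p'")
          case None
          then show ?thesis
            using r IdInd(1) by auto
        next
          case (Some x)
          then show ?thesis
            using r IdInd(2) by (auto simp: refl_arg_Some dest!: chk'[OF _ wf])
        qed
      next
        case [simp]: (Funext A B f g)
        show ?thesis
          using 1(2) wf by (auto simp: bind simp del: One_nat_def)
            (assumption | rule sound_Funext ext | (rule inf, assumption) |
             (rule chk(2), assumption) | (rule inf_conv, assumption))+
      next
        case [simp]: (Univalence u A B)
        show ?thesis
          using 1(2) wf by (auto simp: bind simp del: One_nat_def)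
            (assumption | rule sound_Univalence ext | (rule inf, assumption) |
             (rule chk(2), assumption) | (rule inf_conv, assumption))+
      qed (use 1(2) in auto)
      then show ?thesis
        by (simp add: P_def)
    next
      case [simp]: (Some S)
      have switch: "sound \<Gamma> t (fst r) S \<and> snd r = S"
        if wf: "wf_ctx \<Gamma>"
        and r: "(case unannotated t of
         None \<Rightarrow> nf None \<Gamma> t \<bind> (\<lambda>(t, T). guard (subtype T S) \<bind> (\<lambda>_. Some (t, S)))
       | Some (f, k) \<Rightarrow> var_type \<Gamma> k \<bind> (\<lambda>A. Some (ren (\<lambda>n. if n = k then 0 else Suc n) S) \<bind> (\<lambda>B.
           guard (inst B (Var k) = S) \<bind> (\<lambda>_. nf (Some (PiT A B)) \<Gamma> f \<bind> (\<lambda>(f, _).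
           (case lam_body f of
              None \<Rightarrow> Some (App f (Var k), S)
            | Some b \<Rightarrow> Some (inst b (Var k)) \<bind> nf (Some S) \<Gamma>)))))) = Some r"
      proof (cases "unannotated t")
        case None
        then show ?thesis
          using r wf by (auto simp: bind intro: sound_subtype[OF inf])
      next
        case (Some fk)
        then obtain f k where fk: "fk = (f, k)" and t: "t = App f (Var k)"
          by (cases fk) (auto simp: unannotated_Some)
        \<comment> \<open>Abstracts variable \<open>k\<close> from \<open>S\<close>. The guard
          supplies the equation \<open>inst B (Var k) = S\<close>, so no property of this renaming
          has to be proved.\<close>
        define B where "B = ren (\<lambda>n. if n = k then 0 else Suc n) S"
        obtain f' U where k: "k < length \<Gamma>" and B: "inst B (Var k) = S"
          and f: "nf (Some (PiT (wk (Suc k) (\<Gamma> ! k)) B)) \<Gamma> f = Some (f', U)"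
          and r: "(case lam_body f' of None \<Rightarrow> Some (App f' (Var k), S)
             | Some b \<Rightarrow> Some (inst b (Var k)) \<bind> nf (Some S) \<Gamma>) = Some r"
          using r Some fk by (auto simp: bind B_def )
        have "sound \<Gamma> (Var k) (Var k) (wk (Suc k) (\<Gamma> ! k))"
          using wf k by (auto simp: canonical_def intro!: sound_refl ty_var)
        note App = sound_App[OF chk(2)[OF f wf] this, of S]
        show ?thesis
        proof (cases "lam_body f'")
          case None
          then show ?thesis
            using r App(1) B t by (auto simp: conv_def)
        next
          case (Some b)
          then show ?thesis
            using r App(2) B t by (auto simp: lam_body_Some conv_def dest!: chk'[OF _ wf])
        qed
      qed
      have "sound \<Gamma> t (fst r) S \<and> snd r = S" if wf: "wf_ctx \<Gamma>"
      proof (cases t)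
        case [simp]: (Lam A b)
        obtain A' B i b' U where S: "S = PiT A' B" and A: "nf None \<Gamma> A = Some (A', Univ i)"
          and b: "nf (Some B) (A' # \<Gamma>) b = Some (b', U)"
          and r: "(case eta_head b' of None \<Rightarrow> Some (Lam A' b', PiT A' B)
             | Some f \<Rightarrow> nf None \<Gamma> f \<bind>
                 (\<lambda>r. Some (if r = (f, PiT A' B) then r else (Lam A' b', PiT A' B)))) = Some r"
          using 1(2) by (auto simp: bind split: tm.splits)
        note Lam = sound_Lam[OF inf[OF A wf] chk(2)[OF b ext[OF A wf]]]
        show ?thesis
          using r S Lam(1) Lam(2)[OF eta_head_Some inf[OF _ wf]]
          by (auto simp: bind split: option.splits if_splits)
      next
        case [simp]: (Pair a b)
        obtain A B i j a' U S' b' U' where S: "S = SigT A B" and A: "nf None \<Gamma> A = Some (A, Univ i)"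
          and B: "nf None (A # \<Gamma>) B = Some (B, Univ j)"
          and a: "nf (Some A) \<Gamma> a = Some (a', U)"
          and S': "(if intro a' then nf None \<Gamma> (inst B a') \<bind> dest_type else Some (inst B a')) = Some S'"
          and b: "nf (Some S') \<Gamma> b = Some (b', U')"
          and r: "r = (Pair a' b', SigT A B)"
          using 1(2) by (auto simp: bind split: tm.splits)
        show ?thesis
          using r S sound_Pair[OF soundD(1)[OF inf[OF B ext[OF A wf]]]
            chk(2)[OF a wf] if_conv[OF S' wf] chk(2)[OF b wf]]
          by simp
      next
        case [simp]: (Refl a)
        obtain A i a' U where S: "S = IdT A a' a'" and A: "nf None \<Gamma> A = Some (A, Univ i)"
          and a: "nf (Some A) \<Gamma> a = Some (a', U)" and r: "r = (Refl a', IdT A a' a')"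
          using 1(2) by (auto simp: bind split: tm.splits)
        show ?thesis
          using sound_Refl[OF soundD(1)[OF inf[OF A wf]] chk(2)[OF a wf]] r S by simp
      qed (use 1(2) switch[OF wf] in \<open>simp_all only: Some option.case tm.case\<close>)
      then show ?thesis
        by (simp add: P_def)
    qed
  qed
  from this[OF assms(1)] assms(2) show ?thesis
    by (simp add: P_def)
qed

section \<open>Terms with named variables\<close>

text \<open>
  A term with free de Bruijn \<^emph>\<open>levels\<close> is a function of the number of variables in scope; this gives
  binders in higher-order abstract syntax.
\<close>

type_synonym sc = "nat \<Rightarrow> tm"

named_theorems surface

definition var :: "nat \<Rightarrow> sc" where [surface]: "var l n = Var (n - Suc l)"

definition bind1 :: "(sc \<Rightarrow> sc) \<Rightarrow> sc" where
  [surface]: "bind1 b n = b (var n) (Suc n)"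

definition bind2 :: "(sc \<Rightarrow> sc \<Rightarrow> sc) \<Rightarrow> sc" where
  [surface]: "bind2 b n = bind1 (b (var n)) (Suc n)"

definition bind3 :: "(sc \<Rightarrow> sc \<Rightarrow> sc \<Rightarrow> sc) \<Rightarrow> sc" where
  [surface]: "bind3 b n = bind2 (b (var n)) (Suc n)"

definition univ :: "nat \<Rightarrow> sc" where [surface]: "univ i n = Univ i"

definition pi_type :: "sc \<Rightarrow> (sc \<Rightarrow> sc) \<Rightarrow> sc" where [surface]: "pi_type A B n = PiT (A n) (bind1 B n)"

definition lam :: "sc \<Rightarrow> (sc \<Rightarrow> sc) \<Rightarrow> sc" where [surface]: "lam A b n = Lam (A n) (bind1 b n)"

definition app :: "sc \<Rightarrow> sc \<Rightarrow> sc" (infixl \<open>\<bullet>\<close> 85) where [surface]: "(f \<bullet> a) n = App (f n) (a n)"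

definition sig_type :: "sc \<Rightarrow> (sc \<Rightarrow> sc) \<Rightarrow> sc" where [surface]: "sig_type A B n = SigT (A n) (bind1 B n)"

definition pair :: "sc \<Rightarrow> sc \<Rightarrow> sc" (\<open>\<langle>_,/ _\<rangle>\<close>) where [surface]: "\<langle>a, b\<rangle> n = Pair (a n) (b n)"

definition sig_rec :: "sc \<Rightarrow> (sc \<Rightarrow> sc) \<Rightarrow> (sc \<Rightarrow> sc) \<Rightarrow> (sc \<Rightarrow> sc \<Rightarrow> sc) \<Rightarrow> sc \<Rightarrow> sc" where
  [surface]: "sig_rec A B C g p n = SigInd (A n) (bind1 B n) (bind1 C n) (bind2 g n) (p n)"

definition path :: "sc \<Rightarrow> sc \<Rightarrow> sc \<Rightarrow> sc" where [surface]: "path A a b n = IdT (A n) (a n) (b n)"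

definition rfl :: "sc \<Rightarrow> sc" where [surface]: "rfl a n = Refl (a n)"

definition path_rec :: "sc \<Rightarrow> (sc \<Rightarrow> sc \<Rightarrow> sc \<Rightarrow> sc) \<Rightarrow> (sc \<Rightarrow> sc) \<Rightarrow> sc \<Rightarrow> sc \<Rightarrow> sc \<Rightarrow> sc" where
  [surface]: "path_rec A C c a b p n = IdInd (A n) (bind3 C n) (bind1 c n) (a n) (b n) (p n)"

definition funext :: "sc \<Rightarrow> (sc \<Rightarrow> sc) \<Rightarrow> sc \<Rightarrow> sc \<Rightarrow> sc" where
  [surface]: "funext A B f g n = Funext (A n) (bind1 B n) (f n) (g n)"

definition univalence :: "nat \<Rightarrow> sc \<Rightarrow> sc \<Rightarrow> sc" where
  [surface]: "univalence i A B n = Univalence i (A n) (B n)"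

definition arr :: "sc \<Rightarrow> sc \<Rightarrow> sc" (infixr \<open>\<rightharpoonup>\<close> 60) where
  [surface]: "(A \<rightharpoonup> B) n = arrow (A n) (B n)"

definition prod_type :: "sc \<Rightarrow> sc \<Rightarrow> sc" (infixr \<open>\<otimes>\<close> 70) where
  [surface]: "(A \<otimes> B) n = product (A n) (B n)"

definition identity :: "sc \<Rightarrow> sc" where [surface]: "identity A n = idfun (A n)"

definition compose :: "sc \<Rightarrow> sc \<Rightarrow> sc \<Rightarrow> sc" where
  [surface]: "compose A g f n = composite (A n) (g n) (f n)"

definition homotopic :: "sc \<Rightarrow> sc \<Rightarrow> sc \<Rightarrow> sc \<Rightarrow> sc" where
  [surface]: "homotopic A B f g n = homotopy (A n) (B n) (f n) (g n)"

definition happ :: "sc \<Rightarrow> (sc \<Rightarrow> sc) \<Rightarrow> sc \<Rightarrow> sc \<Rightarrow> sc" where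
  [surface]: "happ A B f g n = happly (A n) (bind1 B n) (f n) (g n)"

definition is_equiv :: "sc \<Rightarrow> sc \<Rightarrow> sc \<Rightarrow> sc" where
  [surface]: "is_equiv A B f n = isEquiv (A n) (B n) (f n)"

definition eqv :: "sc \<Rightarrow> sc \<Rightarrow> sc" where [surface]: "eqv A B n = Equiv (A n) (B n)"

definition id_eqv :: "sc \<Rightarrow> sc" where [surface]: "id_eqv A n = id_equiv (A n)"

definition path_to_eqv :: "nat \<Rightarrow> sc \<Rightarrow> sc \<Rightarrow> sc" where
  [surface]: "path_to_eqv i A B n = idtoeqv i (A n) (B n)"

definition is_umap :: "sc \<Rightarrow> sc \<Rightarrow> sc \<Rightarrow> sc" where
  [surface]: "is_umap A B R n = isUMap (A n) (B n) (R n)"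

definition flip :: "sc \<Rightarrow> sc \<Rightarrow> sc \<Rightarrow> sc" where
  [surface]: "flip A B R n = converse_rel (A n) (B n) (R n)"

definition umap_rel :: "nat \<Rightarrow> sc \<Rightarrow> sc \<Rightarrow> sc" where
  [surface]: "umap_rel i A B n = UMapRel i (A n) (B n)"

syntax
  "_pi_type" :: "pttrn \<Rightarrow> sc \<Rightarrow> sc \<Rightarrow> sc" (\<open>(\<open>indent=2\<close>\<Pi> _ : _./ _)\<close> [0, 0, 60] 60)
  "_sig_type" :: "pttrn \<Rightarrow> sc \<Rightarrow> sc \<Rightarrow> sc" (\<open>(\<open>indent=2\<close>\<Sigma> _ : _./ _)\<close> [0, 0, 60] 60)
  "_lam" :: "pttrn \<Rightarrow> sc \<Rightarrow> sc \<Rightarrow> sc" (\<open>(\<open>indent=2\<close>\<Lambda> _ : _./ _)\<close> [0, 0, 60] 60)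
translations
  "\<Pi> x : A. B" \<rightleftharpoons> "CONST pi_type A (\<lambda>x. B)"
  "\<Sigma> x : A. B" \<rightleftharpoons> "CONST sig_type A (\<lambda>x. B)"
  "\<Lambda> x : A. b" \<rightleftharpoons> "CONST lam A (\<lambda>x. b)"

definition inhabited :: "sc \<Rightarrow> bool" where
  "inhabited T \<longleftrightarrow> (\<exists>t. [] \<turnstile> t \<^bold>: T 0)"

text \<open>Arguments of \<open>nf\<close> are never rewritten in place during evaluation. Passing
  them through \<open>Some\<close> and a bind makes them scrutinees, which are.\<close>

definition check :: "sc \<Rightarrow> sc \<Rightarrow> bool" where
  [surface]: "check t T \<longleftrightarrow>
     Some (T 0) \<bind> nf None [] \<bind> dest_type \<bind> (\<lambda>S. Some (t 0) \<bind> nf (Some S) []) \<noteq> None"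

lemma inhabited_check:
  assumes "check t T"
  shows "inhabited T"
proof -
  obtain T' i t' U where T: "nf None [] (T 0) = Some (T', Univ i)"
    and t: "nf (Some T') [] (t 0) = Some (t', U)"
    using assms by (auto simp: check_def Option.bind_eq_Some_conv)
  have "[] \<turnstile> T' \<approx> T 0 \<^bold>: Univ i" "[] \<turnstile> t' \<^bold>: T'"
    using nf_sound[OF T ctx_empty] nf_sound[OF t ctx_empty] by (auto simp: sound_def)
  then show ?thesis
    unfolding inhabited_def by (blast intro: ty_conv)
qed

section \<open>Instantiation undoes weakening\<close>

lemma up_up_ren: "up \<sigma> \<circ> up_ren \<xi> = up (\<sigma> \<circ> \<xi>)"
  by (auto simp: up_def up_ren_def scons_def fun_eq_iff split: nat.split)

lemma subst_ren: "subst \<sigma> (ren \<xi> t) = subst (\<sigma> \<circ> \<xi>) t"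
  by (induction t arbitrary: \<sigma> \<xi>) (simp_all add: up_up_ren)

lemma up_Var: "up Var = Var"
  by (auto simp: up_def scons_def wk_def fun_eq_iff split: nat.split)

lemma subst_Var: "subst Var t = t"
  by (induction t) (simp_all add: up_Var)

lemma inst_wk: "inst (wk 1 t) a = t"
proof -
  have "(a \<cdot> Var) \<circ> (\<lambda>n. n + 1) = Var"
    by (simp add: scons_def fun_eq_iff)
  then show ?thesis
    by (simp add: inst_def wk_def subst_ren subst_Var)
qed

text \<open>Lets a proof term take earlier results as bound variables. These are neutral for the
  checker, so the proofs behind them are never unfolded and each certificate stays small.\<close>

lemma inhabited_mp: "inhabited (S \<rightharpoonup> T) \<Longrightarrow> inhabited S \<Longrightarrow> inhabited T"
  unfolding inhabited_def arr_def arrow_def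
  using ty_app[where B = "wk 1 (T 0)"] by (metis inst_wk)

subsection \<open>Evaluation\<close>

text \<open>
  The simplifier contracts a function of two arguments only after it has rewritten the body under
  the second abstraction.  Hence pair patterns are split into two successive binds.
\<close>

lemma case_prod_bind: "case_prod f = (\<lambda>p. Some (fst p) \<bind> (\<lambda>a. Some (snd p) \<bind> f a))"
  by (simp add: fun_eq_iff split: prod.split)

lemma bind_Some_const: "Option.bind (Some x) (\<lambda>_. y) = y"
  by simp

lemmas nf_unfold = option.case tm.case case_prod_bind bind_Some_const

text \<open>The general recursion equation would rewrite forever. Its instances fire only once mode
  and head constructor are known, and have these case distinctions already resolved.\<close>

lemmas nf_infer =
  nf.simps[of None _ "Var k", unfolded nf_unfold]
  nf.simps[of None _ "Univ i", unfolded nf_unfold]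
  nf.simps[of None _ "PiT A B", unfolded nf_unfold]
  nf.simps[of None _ "Lam A b", unfolded nf_unfold]
  nf.simps[of None _ "App f a", unfolded nf_unfold]
  nf.simps[of None _ "SigT A B", unfolded nf_unfold]
  nf.simps[of None _ "SigInd A B C g p", unfolded nf_unfold]
  nf.simps[of None _ "IdT A a b", unfolded nf_unfold]
  nf.simps[of None _ "IdInd A C c a b p", unfolded nf_unfold]
  nf.simps[of None _ "Funext A B f g", unfolded nf_unfold]
  nf.simps[of None _ "Univalence i A B", unfolded nf_unfold]
  for k i A B C a b c f g p

lemmas nf_check_intro =
  nf.simps[of "Some (PiT A\<^sub>1 B)" _ "Lam A b", unfolded nf_unfold]
  nf.simps[of "Some (SigT A B)" _ "Pair a b", unfolded nf_unfold]
  nf.simps[of "Some (IdT A x y)" _ "Refl a", unfolded nf_unfold]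
  nf.simps[of "Some T" _ "App f a", unfolded nf_unfold]
  for A A\<^sub>1 B T a b f x y

lemmas nf_check_elim =
  nf.simps[of "Some T" _ "Var k", unfolded unannotated_def nf_unfold]
  nf.simps[of "Some T" _ "Univ i", unfolded unannotated_def nf_unfold]
  nf.simps[of "Some T" _ "PiT A B", unfolded unannotated_def nf_unfold]
  nf.simps[of "Some T" _ "SigT A B", unfolded unannotated_def nf_unfold]
  nf.simps[of "Some T" _ "SigInd A B C g p", unfolded unannotated_def nf_unfold]
  nf.simps[of "Some T" _ "IdT A a b", unfolded unannotated_def nf_unfold]
  nf.simps[of "Some T" _ "IdInd A C c a b p", unfolded unannotated_def nf_unfold]
  nf.simps[of "Some T" _ "Funext A B f g", unfolded unannotated_def nf_unfold]
  nf.simps[of "Some T" _ "Univalence i A B", unfolded unannotated_def nf_unfold]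
  for T k i A B C a b c f g p

lemma bind_eval: "Option.bind (Some c) f = f c"
  by simp

lemma guard_eval: "guard True = Some ()"
  by (simp add: guard_def)

lemma subtype_eval: "subtype T T" "i \<le> j \<Longrightarrow> subtype (Univ i) (Univ j)"
  by (simp_all add: subtype_def)

text \<open>The level \<open>i\<close> stays a free variable, so only comparisons of symbolic levels
  at most two apart arise.\<close>

lemma level_eval:
  "n \<le> Suc n" "n \<le> Suc (Suc n)"
  "max n (Suc n) = Suc n" "max (Suc n) n = Suc n"
  "max n (Suc (Suc n)) = Suc (Suc n)" "max (Suc (Suc n)) n = Suc (Suc n)"
  for n :: nat
  by simp_all

lemma up_ren_eval: "up_ren \<xi> 0 = 0" "up_ren \<xi> (Suc n) = Suc (\<xi> n)"
  by (simp_all add: up_ren_def)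

lemma up_eval: "up \<sigma> 0 = Var 0" "up \<sigma> (Suc n) = wk 1 (\<sigma> n)"
  by (simp_all add: up_def scons_def)

lemma scons_eval: "(t \<cdot> \<sigma>) 0 = t" "(t \<cdot> \<sigma>) (Suc n) = \<sigma> n"
  by (simp_all add: scons_def)

lemma wk_eval: "wk k t = ren (\<lambda>n. n + k) t"
  by (simp add: wk_def)

lemmas nat_eval =
  numeral_nat One_nat_def add_0_right add_Suc_right add_0_left add_Suc diff_zero diff_Suc_Suc diff_0_eq_0

lemmas term_eval =
  arrow_def product_def idfun_def composite_def homotopy_def isEquiv_def Equiv_def id_equiv_def
  happly_def idtoeqv_def isUMap_def converse_rel_def UMapRel_def Let_def

lemmas nf_eval =
  nf_infer nf_check_intro nf_check_elim bind_eval guard_eval subtype_eval level_eval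
  dest_univ.simps(1) dest_type.simps(1) dest_pi.simps(1) intro.simps check_only.simps
  lam_body.simps pair_subst.simps refl_arg.simps
  unannotated_def eta_head_def inst_def subst.simps ren.simps up_eval up_ren_eval scons_eval wk_eval
  option.case tm.case if_True if_False lookup.simps(1,2) var_type_def
  tm.inject tm.distinct nat.inject nat.distinct n_not_Suc_n Suc_n_not_n max.idem order_refl Suc_le_mono
  fst_conv snd_conv prod.inject option.distinct simp_thms term_eval

text \<open>
  Only scrutinees may be evaluated: evaluating the continuation of a bind would not terminate.  The
  arguments of \<open>nf\<close> and the components of its results are normal when they are formed, so traversing
  them again is suppressed as well.
\<close>

lemma nf_eval_cong:
  "x = y \<Longrightarrow> Option.bind x f = Option.bind y f"
  "k = l \<Longrightarrow> lookup \<Gamma> k = lookup \<Gamma> l"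
  "nf m \<Gamma> t = nf m \<Gamma> t"
  "(p, q) = (p, q)"
  by simp_all

lemmas nf_eval_congs =
  nf_eval_cong if_weak_cong tm.case_cong_weak option.case_cong_weak

section \<open>Path induction and function extensionality\<close>

definition proj1 where [surface]:
  "proj1 A B p = (sig_rec A B (\<lambda>z. A) (\<lambda>x y. x) p)"

definition proj2 where [surface]:
  "proj2 A B p = (sig_rec A B (\<lambda>z. B (proj1 A B z)) (\<lambda>x y. y) p)"

text \<open>Based path induction. Level \<open>Suc i\<close> admits \<open>univ i\<close> itself as
  the type \<open>A\<close>, as induction on equivalences requires.\<close>

definition path_induction :: "nat \<Rightarrow> sc" where [surface]:
  "path_induction i = (
    \<Pi> A : univ (Suc i). \<Pi> a : A.
    \<Pi> C : (\<Pi> x : A. path A a x \<rightharpoonup> univ (Suc i)).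
    C \<bullet> a \<bullet> rfl a \<rightharpoonup> \<Pi> x : A. \<Pi> p : path A a x. C \<bullet> x \<bullet> p)"

text \<open>
  The recursor \<open>path_rec\<close> has both endpoints free, so the family \<open>C\<close>,
  which fixes one of them, is moved into the motive.
\<close>

lemma inhabited_path_induction: "inhabited (path_induction i)"
  by (rule inhabited_check[where t = "
    \<Lambda> A : univ (Suc i). \<Lambda> a : A. \<Lambda> C : (\<Pi> x : A. path A a x \<rightharpoonup> univ (Suc i)).
    \<Lambda> c : C \<bullet> a \<bullet> rfl a. \<Lambda> x : A. \<Lambda> p : path A a x.
    path_rec A
      (\<lambda>x y p. \<Pi> C : (\<Pi> z : A. path A x z \<rightharpoonup> univ (Suc i)). C \<bullet> x \<bullet> rfl x \<rightharpoonup> C \<bullet> y \<bullet> p)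
      (\<lambda>x. \<Lambda> C : (\<Pi> z : A. path A x z \<rightharpoonup> univ (Suc i)). \<Lambda> c : C \<bullet> x \<bullet> rfl x. c)
      a x p \<bullet> C \<bullet> c"])
    (simp only: surface nat_eval, simp only: nf_eval nat_eval cong: nf_eval_congs)

text \<open>Inverse of the first path followed by the second, in a single recursion. It joins any
  two points through a centre of contraction.\<close>

definition path_euclid :: "nat \<Rightarrow> sc" where [surface]:
  "path_euclid i = (
    \<Pi> A : univ (Suc i). \<Pi> z : A. \<Pi> x : A. \<Pi> y : A.
    path A z x \<rightharpoonup> path A z y \<rightharpoonup> path A x y)"

lemma inhabited_path_euclid: "inhabited (path_euclid i)"
  by (rule inhabited_check[where t = "
    \<Lambda> A : univ (Suc i). \<Lambda> z : A. \<Lambda> x : A. \<Lambda> y : A. \<Lambda> p : path A z x.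
    path_rec A (\<lambda>z x p. path A z y \<rightharpoonup> path A x y) (\<lambda>x. \<Lambda> q : path A x y. q) z x p"])
    (simp only: surface nat_eval, simp only: nf_eval nat_eval cong: nf_eval_congs)

text \<open>The map \<open>k\<close> is composition with the inverse of \<open>q\<close>. Its value
  at \<open>q\<close> is the base case of the path induction in
  \<open>retract_equiv\<close>.\<close>

definition path_cancel :: "nat \<Rightarrow> sc" where [surface]:
  "path_cancel i = (
    \<Pi> A : univ (Suc i). \<Pi> x : A. \<Pi> y : A. \<Pi> q : path A x y.
    \<Sigma> k : (\<Pi> z : A. path A x z \<rightharpoonup> path A y z). path (path A y y) (k \<bullet> y \<bullet> q) (rfl y))"

lemma inhabited_path_cancel: "inhabited (path_cancel i)"
  by (rule inhabited_check[where t = "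
    \<Lambda> A : univ (Suc i). \<Lambda> x : A. \<Lambda> y : A. \<Lambda> q : path A x y.
    path_rec A
      (\<lambda>x y q. \<Sigma> k : (\<Pi> z : A. path A x z \<rightharpoonup> path A y z). path (path A y y) (k \<bullet> y \<bullet> q) (rfl y))
      (\<lambda>x. \<langle>\<Lambda> z : A. \<Lambda> r : path A x z. r, rfl (rfl x)\<rangle>) x y q"])
    (simp only: surface nat_eval, simp only: nf_eval nat_eval cong: nf_eval_congs)

section \<open>Function extensionality from the inverse of \<open>happly\<close>\<close>

definition right_inverses where [surface]:
  "right_inverses A B f = (
    \<Sigma> g : (B \<rightharpoonup> A). homotopic B B (compose B f g) (identity B))"

definition left_inverses where [surface]:
  "left_inverses A B f = (
    \<Sigma> g : (B \<rightharpoonup> A). homotopic A A (compose A g f) (identity A))"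

text \<open>Both axioms are used through this: it turns a homotopy, or an equivalence, into a path
  with the prescribed image.\<close>

definition equiv_preimage :: "nat \<Rightarrow> sc" where [surface]:
  "equiv_preimage i = (
    \<Pi> A : univ (Suc i). \<Pi> B : univ (Suc i). \<Pi> f : (A \<rightharpoonup> B).
    is_equiv A B f \<rightharpoonup> \<Pi> y : B. \<Sigma> x : A. path B (f \<bullet> x) y)"

lemma inhabited_equiv_preimage: "inhabited (equiv_preimage i)"
  by (rule inhabited_check[where t = "
    \<Lambda> A : univ (Suc i). \<Lambda> B : univ (Suc i). \<Lambda> f : (A \<rightharpoonup> B). \<Lambda> w : is_equiv A B f. \<Lambda> y : B.
    sig_rec (right_inverses A B f) (\<lambda>s. left_inverses A B f) (\<lambda>w. \<Sigma> x : A. path B (f \<bullet> x) y)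
      (\<lambda>s r. sig_rec (B \<rightharpoonup> A) (\<lambda>g. homotopic B B (compose B f g) (identity B))
        (\<lambda>s. \<Sigma> x : A. path B (f \<bullet> x) y)
        (\<lambda>g h. \<langle>g \<bullet> y, h \<bullet> y\<rangle>) s) w"])
    (simp only: surface nat_eval, simp only: nf_eval nat_eval cong: nf_eval_congs)

definition function_ext :: "nat \<Rightarrow> sc" where [surface]:
  "function_ext i = (
    \<Pi> A : univ (Suc i). \<Pi> B : (A \<rightharpoonup> univ (Suc i)).
    \<Pi> f : (\<Pi> x : A. B \<bullet> x). \<Pi> g : (\<Pi> x : A. B \<bullet> x).
    (\<Pi> x : A. path (B \<bullet> x) (f \<bullet> x) (g \<bullet> x)) \<rightharpoonup> path (\<Pi> x : A. B \<bullet> x) f g)"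

lemma inhabited_function_ext: "inhabited (function_ext i)"
proof (rule inhabited_mp[OF _ inhabited_equiv_preimage])
  show "inhabited (equiv_preimage i \<rightharpoonup> function_ext i)"
    by (rule inhabited_check[where t = "
      \<Lambda> P : equiv_preimage i.
      \<Lambda> A : univ (Suc i). \<Lambda> B : (A \<rightharpoonup> univ (Suc i)). \<Lambda> f : (\<Pi> x : A. B \<bullet> x). \<Lambda> g : (\<Pi> x : A. B \<bullet> x).
      \<Lambda> h : (\<Pi> x : A. path (B \<bullet> x) (f \<bullet> x) (g \<bullet> x)).
      proj1 (path (\<Pi> x : A. B \<bullet> x) f g)
        (\<lambda>p. path (\<Pi> x : A. path (B \<bullet> x) (f \<bullet> x) (g \<bullet> x)) (happ A (\<lambda>x. B \<bullet> x) f g \<bullet> p) h)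
        (P \<bullet> path (\<Pi> x : A. B \<bullet> x) f g \<bullet> (\<Pi> x : A. path (B \<bullet> x) (f \<bullet> x) (g \<bullet> x))
          \<bullet> happ A (\<lambda>x. B \<bullet> x) f g \<bullet> funext A (\<lambda>x. B \<bullet> x) f g \<bullet> h)"])
      (simp only: surface nat_eval, simp only: nf_eval nat_eval cong: nf_eval_congs)
qed

section \<open>Induction on homotopies\<close>

definition from_paths where [surface]:
  "from_paths A c = (\<Sigma> y : A. path A c y)"

definition from_point where [surface]:
  "from_point A c z = (proj1 A (\<lambda>y. path A c y) z)"

definition from_path where [surface]:
  "from_path A c z = (proj2 A (\<lambda>y. path A c y) z)"

definition to_paths where [surface]:
  "to_paths A c = (\<Sigma> y : A. path A y c)"

definition to_point where [surface]:
  "to_point A c z = (proj1 A (\<lambda>y. path A y c) z)"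

definition to_path where [surface]:
  "to_path A c z = (proj2 A (\<lambda>y. path A y c) z)"

definition homotopy_induction :: "nat \<Rightarrow> sc" where [surface]:
  "homotopy_induction i = (
    \<Pi> A : univ (Suc i). \<Pi> B : (A \<rightharpoonup> univ (Suc i)). \<Pi> f : (\<Pi> x : A. B \<bullet> x).
    \<Pi> C : (\<Pi> g : (\<Pi> x : A. B \<bullet> x). (\<Pi> x : A. path (B \<bullet> x) (f \<bullet> x) (g \<bullet> x)) \<rightharpoonup> univ (Suc i)).
    C \<bullet> f \<bullet> (\<Lambda> x : A. rfl (f \<bullet> x)) \<rightharpoonup>
    \<Pi> g : (\<Pi> x : A. B \<bullet> x). \<Pi> h : (\<Pi> x : A. path (B \<bullet> x) (f \<bullet> x) (g \<bullet> x)). C \<bullet> g \<bullet> h)"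

text \<open>Splits a function \<open>k\<close> into based path spaces into a function and a
  homotopy. On a function given by pairs the projections compute, and eta leaves \<open>C\<close>
  applied to the original \<open>g\<close> and \<open>h\<close>.\<close>

definition homotopy_motive where [surface]:
  "homotopy_motive A B f C k = (
    C \<bullet> (\<Lambda> x : A. from_point (B \<bullet> x) (f \<bullet> x) (k \<bullet> x)) \<bullet> (\<Lambda> x : A. from_path (B \<bullet> x) (f \<bullet> x) (k \<bullet> x)))"

text \<open>
  A pair \<open>(g, h)\<close> is a function into the based path spaces of the values of
  \<open>f\<close>.  These are contractible, so by function extensionality it equals the function
  for \<open>(f, rfl)\<close>.
\<close>

lemma inhabited_homotopy_induction: "inhabited (homotopy_induction i)"
proof (rule inhabited_mp[OF _ inhabited_function_ext])
  show "inhabited (function_ext i \<rightharpoonup> homotopy_induction i)"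
    by (rule inhabited_check[where t = "
      \<Lambda> F : function_ext i.
      \<Lambda> A : univ (Suc i). \<Lambda> B : (A \<rightharpoonup> univ (Suc i)). \<Lambda> f : (\<Pi> x : A. B \<bullet> x).
      \<Lambda> C : (\<Pi> g : (\<Pi> x : A. B \<bullet> x). (\<Pi> x : A. path (B \<bullet> x) (f \<bullet> x) (g \<bullet> x)) \<rightharpoonup> univ (Suc i)).
      \<Lambda> c : C \<bullet> f \<bullet> (\<Lambda> x : A. rfl (f \<bullet> x)).
      \<Lambda> g : (\<Pi> x : A. B \<bullet> x). \<Lambda> h : (\<Pi> x : A. path (B \<bullet> x) (f \<bullet> x) (g \<bullet> x)).
      path_rec (\<Pi> x : A. from_paths (B \<bullet> x) (f \<bullet> x))
        (\<lambda>k l p. homotopy_motive A B f C k \<rightharpoonup> homotopy_motive A B f C l)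
        (\<lambda>k. \<Lambda> c : homotopy_motive A B f C k. c)
        (\<Lambda> x : A. \<langle>f \<bullet> x, rfl (f \<bullet> x)\<rangle>) (\<Lambda> x : A. \<langle>g \<bullet> x, h \<bullet> x\<rangle>)
        (F \<bullet> A \<bullet> (\<Lambda> x : A. from_paths (B \<bullet> x) (f \<bullet> x))
          \<bullet> (\<Lambda> x : A. \<langle>f \<bullet> x, rfl (f \<bullet> x)\<rangle>) \<bullet> (\<Lambda> x : A. \<langle>g \<bullet> x, h \<bullet> x\<rangle>)
          \<bullet> (\<Lambda> x : A. path_rec (B \<bullet> x) (\<lambda>y z p. path (from_paths (B \<bullet> x) y) \<langle>y, rfl y\<rangle> \<langle>z, p\<rangle>)
              (\<lambda>y. rfl \<langle>y, rfl y\<rangle>) (f \<bullet> x) (g \<bullet> x) (h \<bullet> x)))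
        \<bullet> c"])
      (simp only: surface nat_eval, simp only: nf_eval nat_eval cong: nf_eval_congs)
qed

definition homotopy_induction_left :: "nat \<Rightarrow> sc" where [surface]:
  "homotopy_induction_left i = (
    \<Pi> A : univ (Suc i). \<Pi> B : (A \<rightharpoonup> univ (Suc i)). \<Pi> f : (\<Pi> x : A. B \<bullet> x).
    \<Pi> C : (\<Pi> g : (\<Pi> x : A. B \<bullet> x). (\<Pi> x : A. path (B \<bullet> x) (g \<bullet> x) (f \<bullet> x)) \<rightharpoonup> univ (Suc i)).
    C \<bullet> f \<bullet> (\<Lambda> x : A. rfl (f \<bullet> x)) \<rightharpoonup>
    \<Pi> g : (\<Pi> x : A. B \<bullet> x). \<Pi> h : (\<Pi> x : A. path (B \<bullet> x) (g \<bullet> x) (f \<bullet> x)). C \<bullet> g \<bullet> h)"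

definition homotopy_motive_left where [surface]:
  "homotopy_motive_left A B f C k = (
    C \<bullet> (\<Lambda> x : A. to_point (B \<bullet> x) (f \<bullet> x) (k \<bullet> x)) \<bullet> (\<Lambda> x : A. to_path (B \<bullet> x) (f \<bullet> x) (k \<bullet> x)))"

text \<open>The mirror image of \<open>homotopy_induction\<close>, for homotopies that end in
  \<open>f\<close>. The law of an inverse of the identity has this direction, so it need not be
  reversed.\<close>

lemma inhabited_homotopy_induction_left: "inhabited (homotopy_induction_left i)"
proof (rule inhabited_mp[OF _ inhabited_function_ext])
  show "inhabited (function_ext i \<rightharpoonup> homotopy_induction_left i)"
    by (rule inhabited_check[where t = "
      \<Lambda> F : function_ext i.
      \<Lambda> A : univ (Suc i). \<Lambda> B : (A \<rightharpoonup> univ (Suc i)). \<Lambda> f : (\<Pi> x : A. B \<bullet> x).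
      \<Lambda> C : (\<Pi> g : (\<Pi> x : A. B \<bullet> x). (\<Pi> x : A. path (B \<bullet> x) (g \<bullet> x) (f \<bullet> x)) \<rightharpoonup> univ (Suc i)).
      \<Lambda> c : C \<bullet> f \<bullet> (\<Lambda> x : A. rfl (f \<bullet> x)).
      \<Lambda> g : (\<Pi> x : A. B \<bullet> x). \<Lambda> h : (\<Pi> x : A. path (B \<bullet> x) (g \<bullet> x) (f \<bullet> x)).
      path_rec (\<Pi> x : A. to_paths (B \<bullet> x) (f \<bullet> x))
        (\<lambda>k l p. homotopy_motive_left A B f C k \<rightharpoonup> homotopy_motive_left A B f C l)
        (\<lambda>k. \<Lambda> c : homotopy_motive_left A B f C k. c)
        (\<Lambda> x : A. \<langle>f \<bullet> x, rfl (f \<bullet> x)\<rangle>) (\<Lambda> x : A. \<langle>g \<bullet> x, h \<bullet> x\<rangle>)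
        (F \<bullet> A \<bullet> (\<Lambda> x : A. to_paths (B \<bullet> x) (f \<bullet> x))
          \<bullet> (\<Lambda> x : A. \<langle>f \<bullet> x, rfl (f \<bullet> x)\<rangle>) \<bullet> (\<Lambda> x : A. \<langle>g \<bullet> x, h \<bullet> x\<rangle>)
          \<bullet> (\<Lambda> x : A. path_rec (B \<bullet> x) (\<lambda>z y p. path (to_paths (B \<bullet> x) y) \<langle>y, rfl y\<rangle> \<langle>z, p\<rangle>)
              (\<lambda>y. rfl \<langle>y, rfl y\<rangle>) (g \<bullet> x) (f \<bullet> x) (h \<bullet> x)))
        \<bullet> c"])
      (simp only: surface nat_eval, simp only: nf_eval nat_eval cong: nf_eval_congs)
qed

definition fun3 where [surface]:
  "fun3 A B X Y = (
    \<Pi> a : A. \<Pi> b : B. \<Pi> x : X \<bullet> a \<bullet> b. Y \<bullet> a \<bullet> b)"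

definition homotopy3 where [surface]:
  "homotopy3 A B X Y g f = (
    \<Pi> a : A. \<Pi> b : B. \<Pi> x : X \<bullet> a \<bullet> b.
    path (Y \<bullet> a \<bullet> b) (g \<bullet> a \<bullet> b \<bullet> x) (f \<bullet> a \<bullet> b \<bullet> x))"

definition homotopy_induction3 :: "nat \<Rightarrow> sc" where [surface]:
  "homotopy_induction3 i = (
    \<Pi> A : univ (Suc i). \<Pi> B : univ (Suc i).
    \<Pi> X : (A \<rightharpoonup> B \<rightharpoonup> univ (Suc i)). \<Pi> Y : (A \<rightharpoonup> B \<rightharpoonup> univ (Suc i)). \<Pi> f : fun3 A B X Y.
    \<Pi> C : (\<Pi> g : fun3 A B X Y. homotopy3 A B X Y g f \<rightharpoonup> univ (Suc i)).
    C \<bullet> f \<bullet> (\<Lambda> a : A. \<Lambda> b : B. \<Lambda> x : X \<bullet> a \<bullet> b. rfl (f \<bullet> a \<bullet> b \<bullet> x)) \<rightharpoonup>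
    \<Pi> g : fun3 A B X Y. \<Pi> h : homotopy3 A B X Y g f. C \<bullet> g \<bullet> h)"

definition homotopy_motive3 where [surface]:
  "homotopy_motive3 A B X Y f C k = (
    C \<bullet> (\<Lambda> a : A. \<Lambda> b : B. \<Lambda> x : X \<bullet> a \<bullet> b. to_point (Y \<bullet> a \<bullet> b) (f \<bullet> a \<bullet> b \<bullet> x) (k \<bullet> a \<bullet> b \<bullet> x))
      \<bullet> (\<Lambda> a : A. \<Lambda> b : B. \<Lambda> x : X \<bullet> a \<bullet> b. to_path (Y \<bullet> a \<bullet> b) (f \<bullet> a \<bullet> b \<bullet> x) (k \<bullet> a \<bullet> b \<bullet> x)))"

definition centre where [surface]:
  "centre X f a b = (
    \<Lambda> x : X \<bullet> a \<bullet> b. \<langle>f \<bullet> a \<bullet> b \<bullet> x, rfl (f \<bullet> a \<bullet> b \<bullet> x)\<rangle>)"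

definition paired where [surface]:
  "paired X g h a b = (
    \<Lambda> x : X \<bullet> a \<bullet> b. \<langle>g \<bullet> a \<bullet> b \<bullet> x, h \<bullet> a \<bullet> b \<bullet> x\<rangle>)"

text \<open>Function extensionality at each of the three arguments gives one path from the centre to
  the paired function; a single transport along it finishes.\<close>

lemma inhabited_homotopy_induction3: "inhabited (homotopy_induction3 i)"
proof (rule inhabited_mp[OF _ inhabited_function_ext])
  show "inhabited (function_ext i \<rightharpoonup> homotopy_induction3 i)"
    by (rule inhabited_check[where t = "
      \<Lambda> F : function_ext i.
      \<Lambda> A : univ (Suc i). \<Lambda> B : univ (Suc i).
      \<Lambda> X : (A \<rightharpoonup> B \<rightharpoonup> univ (Suc i)). \<Lambda> Y : (A \<rightharpoonup> B \<rightharpoonup> univ (Suc i)). \<Lambda> f : fun3 A B X Y.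
      \<Lambda> C : (\<Pi> g : fun3 A B X Y. homotopy3 A B X Y g f \<rightharpoonup> univ (Suc i)).
      \<Lambda> c : C \<bullet> f \<bullet> (\<Lambda> a : A. \<Lambda> b : B. \<Lambda> x : X \<bullet> a \<bullet> b. rfl (f \<bullet> a \<bullet> b \<bullet> x)).
      \<Lambda> g : fun3 A B X Y. \<Lambda> h : homotopy3 A B X Y g f.
      path_rec (\<Pi> a : A. \<Pi> b : B. \<Pi> x : X \<bullet> a \<bullet> b. to_paths (Y \<bullet> a \<bullet> b) (f \<bullet> a \<bullet> b \<bullet> x))
        (\<lambda>k l p. homotopy_motive3 A B X Y f C k \<rightharpoonup> homotopy_motive3 A B X Y f C l)
        (\<lambda>k. \<Lambda> c : homotopy_motive3 A B X Y f C k. c)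
        (\<Lambda> a : A. \<Lambda> b : B. centre X f a b) (\<Lambda> a : A. \<Lambda> b : B. paired X g h a b)
        (F \<bullet> A \<bullet> (\<Lambda> a : A. \<Pi> b : B. \<Pi> x : X \<bullet> a \<bullet> b. to_paths (Y \<bullet> a \<bullet> b) (f \<bullet> a \<bullet> b \<bullet> x))
          \<bullet> (\<Lambda> a : A. \<Lambda> b : B. centre X f a b) \<bullet> (\<Lambda> a : A. \<Lambda> b : B. paired X g h a b)
          \<bullet> (\<Lambda> a : A. F \<bullet> B \<bullet> (\<Lambda> b : B. \<Pi> x : X \<bullet> a \<bullet> b. to_paths (Y \<bullet> a \<bullet> b) (f \<bullet> a \<bullet> b \<bullet> x))
            \<bullet> (\<Lambda> b : B. centre X f a b) \<bullet> (\<Lambda> b : B. paired X g h a b)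
            \<bullet> (\<Lambda> b : B. F \<bullet> (X \<bullet> a \<bullet> b) \<bullet> (\<Lambda> x : X \<bullet> a \<bullet> b. to_paths (Y \<bullet> a \<bullet> b) (f \<bullet> a \<bullet> b \<bullet> x))
              \<bullet> centre X f a b \<bullet> paired X g h a b
              \<bullet> (\<Lambda> x : X \<bullet> a \<bullet> b.
                  path_rec (Y \<bullet> a \<bullet> b) (\<lambda>z y p. path (to_paths (Y \<bullet> a \<bullet> b) y) \<langle>y, rfl y\<rangle> \<langle>z, p\<rangle>)
                    (\<lambda>y. rfl \<langle>y, rfl y\<rangle>) (g \<bullet> a \<bullet> b \<bullet> x) (f \<bullet> a \<bullet> b \<bullet> x) (h \<bullet> a \<bullet> b \<bullet> x)))))
        \<bullet> c"])
      (simp only: surface nat_eval, simp only: nf_eval nat_eval cong: nf_eval_congs)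
qed

section \<open>Propositions and equivalences\<close>

definition is_prop where [surface]:
  "is_prop X = (\<Pi> x : X. \<Pi> y : X. path X x y)"

definition product_prop :: "nat \<Rightarrow> sc" where [surface]:
  "product_prop i = (
    \<Pi> X : univ (Suc i). \<Pi> Y : univ (Suc i).
    is_prop X \<rightharpoonup> is_prop Y \<rightharpoonup> is_prop (X \<otimes> Y))"

lemma inhabited_product_prop: "inhabited (product_prop i)"
  by (rule inhabited_check[where t = "
    \<Lambda> X : univ (Suc i). \<Lambda> Y : univ (Suc i). \<Lambda> p : is_prop X. \<Lambda> q : is_prop Y.
    \<Lambda> s : X \<otimes> Y. \<Lambda> t : X \<otimes> Y.
    sig_rec X (\<lambda>x. Y) (\<lambda>s. path (X \<otimes> Y) s t)
      (\<lambda>x y. sig_rec X (\<lambda>x. Y) (\<lambda>t. path (X \<otimes> Y) \<langle>x, y\<rangle> t)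
        (\<lambda>x' y'. path_rec X (\<lambda>x x' p. path (X \<otimes> Y) \<langle>x, y\<rangle> \<langle>x', y'\<rangle>)
          (\<lambda>x. path_rec Y (\<lambda>y y' p. path (X \<otimes> Y) \<langle>x, y\<rangle> \<langle>x, y'\<rangle>) (\<lambda>y. rfl \<langle>x, y\<rangle>) y y' (q \<bullet> y \<bullet> y'))
          x x' (p \<bullet> x \<bullet> x')) t) s"])
    (simp only: surface nat_eval, simp only: nf_eval nat_eval cong: nf_eval_congs)

definition prop_transport :: "nat \<Rightarrow> sc" where [surface]:
  "prop_transport i = (
    \<Pi> X : univ (Suc i). \<Pi> P : (X \<rightharpoonup> univ (Suc i)). \<Pi> x : X. \<Pi> c : P \<bullet> x.
    (\<Pi> u : P \<bullet> x. path (P \<bullet> x) c u) \<rightharpoonup> \<Pi> y : X. path X x y \<rightharpoonup> is_prop (P \<bullet> y))"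

text \<open>Elements over \<open>x\<close> are joined through the centre \<open>c\<close>; path
  induction then moves the claim to \<open>y\<close>. Applied with \<open>x\<close> the graph of a
  function and \<open>y\<close> a relation known to equal it.\<close>

lemma inhabited_prop_transport: "inhabited (prop_transport i)"
proof (rule inhabited_mp[OF _ inhabited_path_euclid],
    rule inhabited_mp[OF _ inhabited_path_induction])
  show "inhabited (path_induction i \<rightharpoonup> path_euclid i \<rightharpoonup> prop_transport i)"
    by (rule inhabited_check[where t = "
      \<Lambda> J : path_induction i. \<Lambda> E : path_euclid i.
      \<Lambda> X : univ (Suc i). \<Lambda> P : (X \<rightharpoonup> univ (Suc i)). \<Lambda> x : X. \<Lambda> c : P \<bullet> x.
      \<Lambda> h : (\<Pi> u : P \<bullet> x. path (P \<bullet> x) c u).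
      J \<bullet> X \<bullet> x \<bullet> (\<Lambda> y : X. \<Lambda> p : path X x y. is_prop (P \<bullet> y))
        \<bullet> (\<Lambda> u : P \<bullet> x. \<Lambda> v : P \<bullet> x. E \<bullet> (P \<bullet> x) \<bullet> c \<bullet> u \<bullet> v \<bullet> (h \<bullet> u) \<bullet> (h \<bullet> v))"])
      (simp only: surface nat_eval, simp only: nf_eval nat_eval cong: nf_eval_congs)
qed

definition subtype_path :: "nat \<Rightarrow> sc" where [surface]:
  "subtype_path i = (
    \<Pi> X : univ (Suc i). \<Pi> P : (X \<rightharpoonup> univ (Suc i)). (\<Pi> x : X. is_prop (P \<bullet> x)) \<rightharpoonup>
    \<Pi> x : X. \<Pi> u : P \<bullet> x. \<Pi> y : X. path X x y \<rightharpoonup> \<Pi> v : P \<bullet> y. path (\<Sigma> x : X. P \<bullet> x) \<langle>x, u\<rangle> \<langle>y, v\<rangle>)"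

lemma inhabited_subtype_path: "inhabited (subtype_path i)"
proof (rule inhabited_mp[OF _ inhabited_path_induction])
  show "inhabited (path_induction i \<rightharpoonup> subtype_path i)"
    by (rule inhabited_check[where t = "
      \<Lambda> J : path_induction i.
      \<Lambda> X : univ (Suc i). \<Lambda> P : (X \<rightharpoonup> univ (Suc i)). \<Lambda> h : (\<Pi> x : X. is_prop (P \<bullet> x)). \<Lambda> x : X. \<Lambda> u : P \<bullet> x.
      J \<bullet> X \<bullet> x
        \<bullet> (\<Lambda> y : X. \<Lambda> p : path X x y. \<Pi> v : P \<bullet> y. path (\<Sigma> x : X. P \<bullet> x) \<langle>x, u\<rangle> \<langle>y, v\<rangle>)
        \<bullet> (\<Lambda> v : P \<bullet> x. path_rec (P \<bullet> x) (\<lambda>u v p. path (\<Sigma> x : X. P \<bullet> x) \<langle>x, u\<rangle> \<langle>x, v\<rangle>)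
            (\<lambda>u. rfl \<langle>x, u\<rangle>) u v (h \<bullet> x \<bullet> u \<bullet> v))"])
      (simp only: surface nat_eval, simp only: nf_eval nat_eval cong: nf_eval_congs)
qed

section \<open>Univalence as induction on equivalences\<close>

definition equiv_to_path :: "nat \<Rightarrow> sc" where [surface]:
  "equiv_to_path i = (
    \<Pi> A : univ i. \<Pi> B : univ i. \<Pi> e : eqv A B.
    \<Sigma> p : path (univ i) A B. path (eqv A B) (path_to_eqv i A B \<bullet> p) e)"

lemma inhabited_equiv_to_path: "inhabited (equiv_to_path i)"
proof (rule inhabited_mp[OF _ inhabited_equiv_preimage])
  show "inhabited (equiv_preimage i \<rightharpoonup> equiv_to_path i)"
    by (rule inhabited_check[where t = "
      \<Lambda> P : equiv_preimage i.
      \<Lambda> A : univ i. \<Lambda> B : univ i.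
      P \<bullet> path (univ i) A B \<bullet> eqv A B \<bullet> path_to_eqv i A B \<bullet> univalence i A B"])
      (simp only: surface nat_eval, simp only: nf_eval nat_eval cong: nf_eval_congs)
qed

definition equiv_induction :: "nat \<Rightarrow> sc" where [surface]:
  "equiv_induction i = (
    \<Pi> A : univ i. \<Pi> C : (\<Pi> B : univ i. eqv A B \<rightharpoonup> univ (Suc i)).
    C \<bullet> A \<bullet> id_eqv A \<rightharpoonup> \<Pi> B : univ i. \<Pi> e : eqv A B. C \<bullet> B \<bullet> e)"

text \<open>Write \<open>e\<close> as the image of a path \<open>p\<close>. At \<open>rfl\<close>
  the canonical map computes to \<open>id_eqv A\<close>, which settles the image by path induction;
  a transport replaces the image by \<open>e\<close>.\<close>

lemma inhabited_equiv_induction: "inhabited (equiv_induction i)"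
proof (rule inhabited_mp[OF _ inhabited_equiv_to_path],
    rule inhabited_mp[OF _ inhabited_path_induction])
  show "inhabited (
    path_induction i \<rightharpoonup>
    equiv_to_path i \<rightharpoonup>
    equiv_induction i)"
    by (rule inhabited_check[where t = "
      \<Lambda> J : path_induction i. \<Lambda> U : equiv_to_path i.
      \<Lambda> A : univ i. \<Lambda> C : (\<Pi> B : univ i. eqv A B \<rightharpoonup> univ (Suc i)). \<Lambda> c : C \<bullet> A \<bullet> id_eqv A.
      \<Lambda> B : univ i. \<Lambda> e : eqv A B.
      sig_rec (path (univ i) A B) (\<lambda>p. path (eqv A B) (path_to_eqv i A B \<bullet> p) e) (\<lambda>z. C \<bullet> B \<bullet> e)
        (\<lambda>p q. path_rec (eqv A B) (\<lambda>d e q. C \<bullet> B \<bullet> d \<rightharpoonup> C \<bullet> B \<bullet> e) (\<lambda>d. \<Lambda> c : C \<bullet> B \<bullet> d. c)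
            (path_to_eqv i A B \<bullet> p) e q
          \<bullet> (J \<bullet> univ i \<bullet> A \<bullet> (\<Lambda> B : univ i. \<Lambda> p : path (univ i) A B. C \<bullet> B \<bullet> (path_to_eqv i A B \<bullet> p))
              \<bullet> c \<bullet> B \<bullet> p))
        (U \<bullet> A \<bullet> B \<bullet> e)"])
      (simp only: surface nat_eval, simp only: nf_eval nat_eval cong: nf_eval_congs)
qed

section \<open>Uniqueness of inverses\<close>

definition inverses_of_id where [surface]:
  "inverses_of_id A = (
    \<Sigma> g : (A \<rightharpoonup> A). \<Pi> x : A. path A (g \<bullet> x) x)"

definition trivial_inverse where [surface]:
  "trivial_inverse A = (\<langle>\<Lambda> x : A. x, \<Lambda> x : A. rfl x\<rangle>)"

definition inverse_trivial where [surface]: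
  "inverse_trivial H A s = (
    sig_rec (A \<rightharpoonup> A) (\<lambda>g. \<Pi> x : A. path A (g \<bullet> x) x) (\<lambda>s. path (inverses_of_id A) (trivial_inverse A) s)
      (\<lambda>g h. H \<bullet> A \<bullet> (\<Lambda> x : A. A) \<bullet> (\<Lambda> x : A. x)
        \<bullet> (\<Lambda> g : (A \<rightharpoonup> A). \<Lambda> h : (\<Pi> x : A. path A (g \<bullet> x) x).
            path (inverses_of_id A) (trivial_inverse A) \<langle>g, h\<rangle>)
        \<bullet> rfl (trivial_inverse A) \<bullet> g \<bullet> h) s)"

definition inverses_of_id_prop :: "nat \<Rightarrow> sc" where [surface]:
  "inverses_of_id_prop i = (\<Pi> A : univ (Suc i). is_prop (inverses_of_id A))"

text \<open>By \<open>homotopy_induction_left\<close> a function with a homotopy to the identity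
  equals the identity with the constant homotopy, and any two such pairs are joined through that
  one.\<close>

lemma inhabited_inverses_of_id_prop: "inhabited (inverses_of_id_prop i)"
proof (rule inhabited_mp[OF _ inhabited_path_euclid],
    rule inhabited_mp[OF _ inhabited_homotopy_induction_left])
  show "inhabited (
    homotopy_induction_left i \<rightharpoonup>
    path_euclid i \<rightharpoonup>
    inverses_of_id_prop i)"
    by (rule inhabited_check[where t = "
      \<Lambda> H : homotopy_induction_left i. \<Lambda> E : path_euclid i.
      \<Lambda> A : univ (Suc i). \<Lambda> s : inverses_of_id A. \<Lambda> t : inverses_of_id A.
      E \<bullet> inverses_of_id A \<bullet> trivial_inverse A \<bullet> s \<bullet> t
        \<bullet> inverse_trivial H A s \<bullet> inverse_trivial H A t"])
      (simp only: surface nat_eval, simp only: nf_eval nat_eval cong: nf_eval_congs)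
qed

definition equiv_fun where [surface]:
  "equiv_fun A B e = (proj1 (A \<rightharpoonup> B) (\<lambda>f. is_equiv A B f) e)"

definition is_equiv_prop :: "nat \<Rightarrow> sc" where [surface]:
  "is_equiv_prop i = (
    \<Pi> A : univ i. \<Pi> B : univ i. \<Pi> f : (A \<rightharpoonup> B). is_prop (is_equiv A B f))"

text \<open>
  By univalence it suffices to treat the identity, whose left and right inverses both form the
  type \<open>inverses_of_id A\<close>.
\<close>

lemma inhabited_is_equiv_prop: "inhabited (is_equiv_prop i)"
proof (rule inhabited_mp[OF _ inhabited_product_prop],
    rule inhabited_mp[OF _ inhabited_inverses_of_id_prop],
    rule inhabited_mp[OF _ inhabited_equiv_induction])
  show "inhabited (
    equiv_induction i \<rightharpoonup>
    inverses_of_id_prop i \<rightharpoonup>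
    product_prop i \<rightharpoonup>
    is_equiv_prop i)"
    by (rule inhabited_check[where t = "
      \<Lambda> E : equiv_induction i. \<Lambda> C : inverses_of_id_prop i.
      \<Lambda> D : product_prop i.
      \<Lambda> A : univ i. \<Lambda> B : univ i. \<Lambda> f : (A \<rightharpoonup> B). \<Lambda> w : is_equiv A B f.
      E \<bullet> A \<bullet> (\<Lambda> B : univ i. \<Lambda> e : eqv A B. is_prop (is_equiv A B (equiv_fun A B e)))
        \<bullet> (D \<bullet> inverses_of_id A \<bullet> inverses_of_id A \<bullet> (C \<bullet> A) \<bullet> (C \<bullet> A))
        \<bullet> B \<bullet> \<langle>f, w\<rangle> \<bullet> w"])
      (simp only: surface nat_eval, simp only: nf_eval nat_eval cong: nf_eval_congs)
qed

definition bijection_equiv :: "nat \<Rightarrow> sc" where [surface]: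
  "bijection_equiv i = (
    \<Pi> X : univ (Suc i). \<Pi> Y : univ (Suc i). \<Pi> f : (X \<rightharpoonup> Y).
    (\<Pi> y : Y. \<Sigma> x : X. path Y (f \<bullet> x) y) \<rightharpoonup>
    (\<Pi> x : X. \<Pi> z : X. path Y (f \<bullet> x) (f \<bullet> z) \<rightharpoonup> path X x z) \<rightharpoonup> eqv X Y)"

definition preimage where [surface]:
  "preimage X Y f s y = (proj1 X (\<lambda>x. path Y (f \<bullet> x) y) (s \<bullet> y))"

definition preimage_path where [surface]:
  "preimage_path X Y f s y = (proj2 X (\<lambda>x. path Y (f \<bullet> x) y) (s \<bullet> y))"

text \<open>The chosen preimages form both inverses. On the left, the preimage of \<open>f x\<close>
  has the same image as \<open>x\<close>, and injectivity reflects this path.\<close>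

lemma inhabited_bijection_equiv: "inhabited (bijection_equiv i)"
  by (rule inhabited_check[where t = "
    \<Lambda> X : univ (Suc i). \<Lambda> Y : univ (Suc i). \<Lambda> f : (X \<rightharpoonup> Y).
    \<Lambda> s : (\<Pi> y : Y. \<Sigma> x : X. path Y (f \<bullet> x) y).
    \<Lambda> j : (\<Pi> x : X. \<Pi> z : X. path Y (f \<bullet> x) (f \<bullet> z) \<rightharpoonup> path X x z).
    \<langle>f, \<langle>\<langle>\<Lambda> y : Y. preimage X Y f s y, \<Lambda> y : Y. preimage_path X Y f s y\<rangle>,
      \<langle>\<Lambda> y : Y. preimage X Y f s y,
       \<Lambda> x : X. j \<bullet> preimage X Y f s (f \<bullet> x) \<bullet> x \<bullet> preimage_path X Y f s (f \<bullet> x)\<rangle>\<rangle>\<rangle>"])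
    (simp only: surface nat_eval, simp only: nf_eval nat_eval cong: nf_eval_congs)

section \<open>Univalent maps are graphs\<close>

definition graph_rel where [surface]:
  "graph_rel A B f = (\<Lambda> a : A. \<Lambda> b : B. path B (f \<bullet> a) b)"

definition umap_intro where [surface]:
  "umap_intro A B R m = (
    \<Pi> a : A. \<Pi> b : B. path B (m \<bullet> a) b \<rightharpoonup> R \<bullet> a \<bullet> b)"

definition umap_elim where [surface]:
  "umap_elim A B R m = (
    \<Pi> a : A. \<Pi> b : B. R \<bullet> a \<bullet> b \<rightharpoonup> path B (m \<bullet> a) b)"

definition umap_law where [surface]:
  "umap_law A B R g k = (
    \<Pi> a : A. \<Pi> b : B. \<Pi> r : R \<bullet> a \<bullet> b.
    path (R \<bullet> a \<bullet> b) (g \<bullet> a \<bullet> b \<bullet> (k \<bullet> a \<bullet> b \<bullet> r)) r)"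

definition umap_tail2 where [surface]:
  "umap_tail2 A B R m g = (\<Sigma> k : umap_elim A B R m. umap_law A B R g k)"

definition umap_tail where [surface]:
  "umap_tail A B R m = (\<Sigma> g : umap_intro A B R m. umap_tail2 A B R m g)"

text \<open>Sigma types have no eta rule, so a variable structure must be split into its four
  components before \<open>umap_fun\<close> computes on it.\<close>

definition umap_cases where [surface]:
  "umap_cases A B R C c u = (
    sig_rec (A \<rightharpoonup> B) (\<lambda>m. umap_tail A B R m) C
      (\<lambda>m s. sig_rec (umap_intro A B R m) (\<lambda>g. umap_tail2 A B R m g) (\<lambda>s. C \<langle>m, s\<rangle>)
        (\<lambda>g t. sig_rec (umap_elim A B R m) (\<lambda>k. umap_law A B R g k) (\<lambda>t. C \<langle>m, \<langle>g, t\<rangle>\<rangle>)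
          (\<lambda>k h. c m g k h) t) s) u)"

definition umap_fun where [surface]:
  "umap_fun A B R u = (proj1 (A \<rightharpoonup> B) (\<lambda>m. umap_tail A B R m) u)"

definition graph_id where [surface]:
  "graph_id A B m = (
    \<Lambda> a : A. \<Lambda> b : B. \<Lambda> p : path B (m \<bullet> a) b. p)"

definition graph_rfl where [surface]:
  "graph_rfl A B m = (
    \<Lambda> a : A. \<Lambda> b : B. \<Lambda> p : path B (m \<bullet> a) b. rfl p)"

definition graph_umap where [surface]:
  "graph_umap A B m = (
    \<langle>m, \<langle>graph_id A B m, \<langle>graph_id A B m, graph_rfl A B m\<rangle>\<rangle>\<rangle>)"

text \<open>Contractibility of the univalent map structures on a graph, as an induction principle.
  It is curried so that homotopy induction can act on one component at a time.\<close>

definition graph_induction :: "nat \<Rightarrow> sc" where [surface]: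
  "graph_induction i = (
    \<Pi> A : univ i. \<Pi> B : univ i. \<Pi> m : (A \<rightharpoonup> B).
    \<Pi> Q : (\<Pi> n : (A \<rightharpoonup> B). \<Pi> g : umap_intro A B (graph_rel A B m) n. \<Pi> k : umap_elim A B (graph_rel A B m) n.
      umap_law A B (graph_rel A B m) g k \<rightharpoonup> univ (Suc i)).
    Q \<bullet> m \<bullet> graph_id A B m \<bullet> graph_id A B m \<bullet> graph_rfl A B m \<rightharpoonup>
    \<Pi> n : (A \<rightharpoonup> B). \<Pi> g : umap_intro A B (graph_rel A B m) n. \<Pi> k : umap_elim A B (graph_rel A B m) n.
    \<Pi> h : umap_law A B (graph_rel A B m) g k. Q \<bullet> n \<bullet> g \<bullet> k \<bullet> h)"

text \<open>
  The paths \<open>g a (n a) rfl : m a = n a\<close> reduce to the case \<open>n = m\<close> with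
  \<open>g a (m a) rfl = rfl\<close>.  Then \<open>g\<close> is homotopic to the identity, and
  once \<open>g\<close> is the identity, \<open>h\<close> is a homotopy from \<open>k\<close> to
  the identity.
\<close>

lemma inhabited_graph_induction: "inhabited (graph_induction i)"
proof (rule inhabited_mp[OF _ inhabited_homotopy_induction3],
    rule inhabited_mp[OF _ inhabited_homotopy_induction],
    rule inhabited_mp[OF _ inhabited_path_euclid],
    rule inhabited_mp[OF _ inhabited_path_induction])
  show "inhabited (
    path_induction i \<rightharpoonup>
    path_euclid i \<rightharpoonup>
    homotopy_induction i \<rightharpoonup>
    homotopy_induction3 i \<rightharpoonup>
    graph_induction i)"
    by (rule inhabited_check[where t = "
      \<Lambda> J : path_induction i. \<Lambda> E : path_euclid i.
      \<Lambda> H : homotopy_induction i. \<Lambda> K : homotopy_induction3 i.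
      \<Lambda> A : univ i. \<Lambda> B : univ i. \<Lambda> m : (A \<rightharpoonup> B).
      \<Lambda> Q : (\<Pi> n : (A \<rightharpoonup> B). \<Pi> g : umap_intro A B (graph_rel A B m) n. \<Pi> k : umap_elim A B (graph_rel A B m) n.
        umap_law A B (graph_rel A B m) g k \<rightharpoonup> univ (Suc i)).
      \<Lambda> c : Q \<bullet> m \<bullet> graph_id A B m \<bullet> graph_id A B m \<bullet> graph_rfl A B m.
      \<Lambda> n : (A \<rightharpoonup> B). \<Lambda> g : umap_intro A B (graph_rel A B m) n.
      H \<bullet> A \<bullet> (\<Lambda> a : A. B) \<bullet> m
        \<bullet> (\<Lambda> n : (A \<rightharpoonup> B). \<Lambda> q : (\<Pi> a : A. path B (m \<bullet> a) (n \<bullet> a)). \<Pi> g : umap_intro A B (graph_rel A B m) n.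
            (\<Pi> a : A. path (path B (m \<bullet> a) (n \<bullet> a)) (q \<bullet> a) (g \<bullet> a \<bullet> (n \<bullet> a) \<bullet> rfl (n \<bullet> a))) \<rightharpoonup>
            \<Pi> k : umap_elim A B (graph_rel A B m) n. \<Pi> h : umap_law A B (graph_rel A B m) g k. Q \<bullet> n \<bullet> g \<bullet> k \<bullet> h)
        \<bullet> (\<Lambda> g : umap_intro A B (graph_rel A B m) m.
           \<Lambda> q : (\<Pi> a : A. path (path B (m \<bullet> a) (m \<bullet> a)) (rfl (m \<bullet> a)) (g \<bullet> a \<bullet> (m \<bullet> a) \<bullet> rfl (m \<bullet> a))).
            K \<bullet> A \<bullet> B \<bullet> graph_rel A B m \<bullet> graph_rel A B m \<bullet> graph_id A B m
              \<bullet> (\<Lambda> g : umap_intro A B (graph_rel A B m) m.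
                 \<Lambda> h : homotopy3 A B (graph_rel A B m) (graph_rel A B m) g (graph_id A B m).
                  \<Pi> k : umap_elim A B (graph_rel A B m) m. \<Pi> h : umap_law A B (graph_rel A B m) g k. Q \<bullet> m \<bullet> g \<bullet> k \<bullet> h)
              \<bullet> (K \<bullet> A \<bullet> B \<bullet> graph_rel A B m \<bullet> graph_rel A B m \<bullet> graph_id A B m \<bullet> (Q \<bullet> m \<bullet> graph_id A B m) \<bullet> c)
              \<bullet> g
              \<bullet> (\<Lambda> a : A. \<Lambda> b : B. \<Lambda> p : path B (m \<bullet> a) b.
                  J \<bullet> B \<bullet> (m \<bullet> a) \<bullet> (\<Lambda> b : B. \<Lambda> p : path B (m \<bullet> a) b. path (path B (m \<bullet> a) b) (g \<bullet> a \<bullet> b \<bullet> p) p)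
                    \<bullet> (E \<bullet> path B (m \<bullet> a) (m \<bullet> a) \<bullet> rfl (m \<bullet> a) \<bullet> (g \<bullet> a \<bullet> (m \<bullet> a) \<bullet> rfl (m \<bullet> a)) \<bullet> rfl (m \<bullet> a)
                        \<bullet> (q \<bullet> a) \<bullet> rfl (rfl (m \<bullet> a)))
                    \<bullet> b \<bullet> p))
        \<bullet> n \<bullet> (\<Lambda> a : A. g \<bullet> a \<bullet> (n \<bullet> a) \<bullet> rfl (n \<bullet> a)) \<bullet> g
        \<bullet> (\<Lambda> a : A. rfl (g \<bullet> a \<bullet> (n \<bullet> a) \<bullet> rfl (n \<bullet> a)))"])
      (simp only: surface nat_eval, simp only: nf_eval nat_eval cong: nf_eval_congs)
qed

definition graph_umap_unique :: "nat \<Rightarrow> sc" where [surface]: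
  "graph_umap_unique i = (
    \<Pi> A : univ i. \<Pi> B : univ i. \<Pi> m : (A \<rightharpoonup> B).
    \<Pi> u : is_umap A B (graph_rel A B m). path (is_umap A B (graph_rel A B m)) (graph_umap A B m) u)"

lemma inhabited_graph_umap_unique: "inhabited (graph_umap_unique i)"
proof (rule inhabited_mp[OF _ inhabited_graph_induction])
  show "inhabited (graph_induction i \<rightharpoonup> graph_umap_unique i)"
    by (rule inhabited_check[where t = "
      \<Lambda> G : graph_induction i.
      \<Lambda> A : univ i. \<Lambda> B : univ i. \<Lambda> m : (A \<rightharpoonup> B). \<Lambda> u : is_umap A B (graph_rel A B m).
      umap_cases A B (graph_rel A B m) (\<lambda>u. path (is_umap A B (graph_rel A B m)) (graph_umap A B m) u)
        (\<lambda>n g k h. G \<bullet> A \<bullet> B \<bullet> m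
          \<bullet> (\<Lambda> n : (A \<rightharpoonup> B). \<Lambda> g : umap_intro A B (graph_rel A B m) n. \<Lambda> k : umap_elim A B (graph_rel A B m) n.
             \<Lambda> h : umap_law A B (graph_rel A B m) g k.
              path (is_umap A B (graph_rel A B m)) (graph_umap A B m) \<langle>n, \<langle>g, \<langle>k, h\<rangle>\<rangle>\<rangle>)
          \<bullet> rfl (graph_umap A B m) \<bullet> n \<bullet> g \<bullet> k \<bullet> h) u"])
      (simp only: surface nat_eval, simp only: nf_eval nat_eval cong: nf_eval_congs)
qed

section \<open>Retracts of based path spaces\<close>

definition retract_equiv :: "nat \<Rightarrow> sc" where [surface]:
  "retract_equiv i = (
    \<Pi> B : univ i. \<Pi> c : B. \<Pi> P : (B \<rightharpoonup> univ i).
    \<Pi> g : (\<Pi> b : B. path B c b \<rightharpoonup> P \<bullet> b). \<Pi> k : (\<Pi> b : B. P \<bullet> b \<rightharpoonup> path B c b).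
    (\<Pi> b : B. \<Pi> r : P \<bullet> b. path (P \<bullet> b) (g \<bullet> b \<bullet> (k \<bullet> b \<bullet> r)) r) \<rightharpoonup> \<Pi> b : B. eqv (path B c b) (P \<bullet> b))"

text \<open>
  A left inverse of \<open>g b\<close> is \<open>k b\<close> followed by composition with the
  inverse of \<open>k c (g c rfl)\<close>.
\<close>

lemma inhabited_retract_equiv: "inhabited (retract_equiv i)"
proof (rule inhabited_mp[OF _ inhabited_path_cancel],
    rule inhabited_mp[OF _ inhabited_path_induction])
  show "inhabited (path_induction i \<rightharpoonup> path_cancel i \<rightharpoonup> retract_equiv i)"
    by (rule inhabited_check[where t = "
      \<Lambda> J : path_induction i. \<Lambda> D : path_cancel i.
      \<Lambda> B : univ i. \<Lambda> c : B. \<Lambda> P : (B \<rightharpoonup> univ i).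
      \<Lambda> g : (\<Pi> b : B. path B c b \<rightharpoonup> P \<bullet> b). \<Lambda> k : (\<Pi> b : B. P \<bullet> b \<rightharpoonup> path B c b).
      \<Lambda> h : (\<Pi> b : B. \<Pi> r : P \<bullet> b. path (P \<bullet> b) (g \<bullet> b \<bullet> (k \<bullet> b \<bullet> r)) r). \<Lambda> b : B.
      \<langle>g \<bullet> b, \<langle>\<langle>k \<bullet> b, h \<bullet> b\<rangle>,
        sig_rec (\<Pi> z : B. path B c z \<rightharpoonup> path B c z)
          (\<lambda>d. path (path B c c) (d \<bullet> c \<bullet> (k \<bullet> c \<bullet> (g \<bullet> c \<bullet> rfl c))) (rfl c))
          (\<lambda>z. left_inverses (path B c b) (P \<bullet> b) (g \<bullet> b))
          (\<lambda>d e. \<langle>\<Lambda> r : P \<bullet> b. d \<bullet> b \<bullet> (k \<bullet> b \<bullet> r),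
            \<Lambda> p : path B c b. J \<bullet> B \<bullet> c
              \<bullet> (\<Lambda> b : B. \<Lambda> p : path B c b. path (path B c b) (d \<bullet> b \<bullet> (k \<bullet> b \<bullet> (g \<bullet> b \<bullet> p))) p)
              \<bullet> e \<bullet> b \<bullet> p\<rangle>)
          (D \<bullet> B \<bullet> c \<bullet> c \<bullet> (k \<bullet> c \<bullet> (g \<bullet> c \<bullet> rfl c)))\<rangle>\<rangle>"])
      (simp only: surface nat_eval, simp only: nf_eval nat_eval cong: nf_eval_congs)
qed

definition umap_is_graph :: "nat \<Rightarrow> sc" where [surface]:
  "umap_is_graph i = (
    \<Pi> A : univ i. \<Pi> B : univ i. \<Pi> R : (A \<rightharpoonup> B \<rightharpoonup> univ i). \<Pi> u : is_umap A B R.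
    path (A \<rightharpoonup> B \<rightharpoonup> univ i) (graph_rel A B (umap_fun A B R u)) R)"

definition graph_equiv where [surface]:
  "graph_equiv B R D m g k h a b = (
    D \<bullet> B \<bullet> (m \<bullet> a) \<bullet> (R \<bullet> a) \<bullet> (g \<bullet> a) \<bullet> (k \<bullet> a) \<bullet> (h \<bullet> a) \<bullet> b)"

lemma inhabited_umap_is_graph: "inhabited (umap_is_graph i)"
proof (rule inhabited_mp[OF _ inhabited_retract_equiv],
    rule inhabited_mp[OF _ inhabited_equiv_to_path],
    rule inhabited_mp[OF _ inhabited_function_ext])
  show "inhabited (
    function_ext i \<rightharpoonup>
    equiv_to_path i \<rightharpoonup>
    retract_equiv i \<rightharpoonup>
    umap_is_graph i)"
    by (rule inhabited_check[where t = "
      \<Lambda> F : function_ext i. \<Lambda> U : equiv_to_path i.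
      \<Lambda> D : retract_equiv i.
      \<Lambda> A : univ i. \<Lambda> B : univ i. \<Lambda> R : (A \<rightharpoonup> B \<rightharpoonup> univ i). \<Lambda> u : is_umap A B R.
      umap_cases A B R (\<lambda>u. path (A \<rightharpoonup> B \<rightharpoonup> univ i) (graph_rel A B (umap_fun A B R u)) R)
        (\<lambda>m g k h. F \<bullet> A \<bullet> (\<Lambda> a : A. B \<rightharpoonup> univ i) \<bullet> graph_rel A B m \<bullet> R
          \<bullet> (\<Lambda> a : A. F \<bullet> B \<bullet> (\<Lambda> b : B. univ i) \<bullet> (\<Lambda> b : B. path B (m \<bullet> a) b) \<bullet> (R \<bullet> a)
            \<bullet> (\<Lambda> b : B. proj1 (path (univ i) (path B (m \<bullet> a) b) (R \<bullet> a \<bullet> b))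
                (\<lambda>p. path (eqv (path B (m \<bullet> a) b) (R \<bullet> a \<bullet> b))
                  (path_to_eqv i (path B (m \<bullet> a) b) (R \<bullet> a \<bullet> b) \<bullet> p) (graph_equiv B R D m g k h a b))
                (U \<bullet> path B (m \<bullet> a) b \<bullet> (R \<bullet> a \<bullet> b) \<bullet> graph_equiv B R D m g k h a b)))) u"])
      (simp only: surface nat_eval, simp only: nf_eval nat_eval cong: nf_eval_congs)
qed

definition is_umap_prop :: "nat \<Rightarrow> sc" where [surface]:
  "is_umap_prop i = (
    \<Pi> A : univ i. \<Pi> B : univ i. \<Pi> R : (A \<rightharpoonup> B \<rightharpoonup> univ i). is_prop (is_umap A B R))"

text \<open>The first element \<open>u\<close> makes \<open>R\<close> equal to the graph of its
  function, where \<open>graph_umap\<close> is a centre; \<open>prop_transport\<close> brings the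
  conclusion back to \<open>R\<close>.\<close>

lemma inhabited_is_umap_prop: "inhabited (is_umap_prop i)"
proof (rule inhabited_mp[OF _ inhabited_umap_is_graph],
    rule inhabited_mp[OF _ inhabited_graph_umap_unique],
    rule inhabited_mp[OF _ inhabited_prop_transport])
  show "inhabited (
    prop_transport i \<rightharpoonup>
    graph_umap_unique i \<rightharpoonup>
    umap_is_graph i \<rightharpoonup>
    is_umap_prop i)"
    by (rule inhabited_check[where t = "
      \<Lambda> T : prop_transport i. \<Lambda> G : graph_umap_unique i.
      \<Lambda> M : umap_is_graph i.
      \<Lambda> A : univ i. \<Lambda> B : univ i. \<Lambda> R : (A \<rightharpoonup> B \<rightharpoonup> univ i). \<Lambda> u : is_umap A B R.
      T \<bullet> (A \<rightharpoonup> B \<rightharpoonup> univ i) \<bullet> (\<Lambda> R : (A \<rightharpoonup> B \<rightharpoonup> univ i). is_umap A B R) \<bullet> graph_rel A B (umap_fun A B R u)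
        \<bullet> graph_umap A B (umap_fun A B R u) \<bullet> (G \<bullet> A \<bullet> B \<bullet> umap_fun A B R u)
        \<bullet> R \<bullet> (M \<bullet> A \<bullet> B \<bullet> R \<bullet> u) \<bullet> u"])
      (simp only: surface nat_eval, simp only: nf_eval nat_eval cong: nf_eval_congs)
qed

section \<open>Equivalences as pairs of univalent maps\<close>

definition path_inv where [surface]:
  "path_inv A x y p = (path_rec A (\<lambda>x y p. path A y x) (\<lambda>x. rfl x) x y p)"

definition converse_graph_umap :: "nat \<Rightarrow> sc" where [surface]:
  "converse_graph_umap i = (
    \<Pi> A : univ i. \<Pi> B : univ i. \<Pi> f : (A \<rightharpoonup> B).
    is_equiv A B f \<rightharpoonup> is_umap B A (flip A B (graph_rel A B f)))"

text \<open>For the identity function the converse graph relates \<open>x\<close> to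
  \<open>y\<close> by paths from \<open>y\<close> to \<open>x\<close>. Path inversion serves in both
  directions, and the law says that inverting twice gives the path back.\<close>

lemma inhabited_converse_graph_umap: "inhabited (converse_graph_umap i)"
proof (rule inhabited_mp[OF _ inhabited_equiv_induction])
  show "inhabited (equiv_induction i \<rightharpoonup> converse_graph_umap i)"
    by (rule inhabited_check[where t = "
      \<Lambda> E : equiv_induction i.
      \<Lambda> A : univ i. \<Lambda> B : univ i. \<Lambda> f : (A \<rightharpoonup> B). \<Lambda> w : is_equiv A B f.
      E \<bullet> A \<bullet> (\<Lambda> B : univ i. \<Lambda> e : eqv A B. is_umap B A (flip A B (graph_rel A B (equiv_fun A B e))))
        \<bullet> \<langle>identity A, \<langle>\<Lambda> x : A. \<Lambda> y : A. \<Lambda> p : path A x y. path_inv A x y p,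
           \<langle>\<Lambda> x : A. \<Lambda> y : A. \<Lambda> p : path A y x. path_inv A y x p,
            \<Lambda> x : A. \<Lambda> y : A. \<Lambda> p : path A y x.
              path_rec A (\<lambda>y x p. path (path A y x) (path_inv A x y (path_inv A y x p)) p)
                (\<lambda>x. rfl (rfl x)) y x p\<rangle>\<rangle>\<rangle>
        \<bullet> B \<bullet> \<langle>f, w\<rangle>"])
      (simp only: surface nat_eval, simp only: nf_eval nat_eval cong: nf_eval_congs)
qed

definition umap_pair_equiv :: "nat \<Rightarrow> sc" where [surface]:
  "umap_pair_equiv i = (
    \<Pi> A : univ i. \<Pi> B : univ i. \<Pi> R : (A \<rightharpoonup> B \<rightharpoonup> univ i).
    \<Pi> u : is_umap A B R. is_umap B A (flip A B R) \<rightharpoonup> is_equiv A B (umap_fun A B R u))"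

text \<open>Let \<open>m\<close> and \<open>n\<close> be the functions of \<open>R\<close> and of
  its converse. From \<open>rfl\<close>, \<open>g'\<close> shows that \<open>n b\<close> is related
  to \<open>b\<close>, and \<open>k\<close> reads this as a path from \<open>m (n b)\<close> to
  \<open>b\<close>; the other side is symmetric.\<close>

lemma inhabited_umap_pair_equiv: "inhabited (umap_pair_equiv i)"
  by (rule inhabited_check[where t = "
    \<Lambda> A : univ i. \<Lambda> B : univ i. \<Lambda> R : (A \<rightharpoonup> B \<rightharpoonup> univ i).
    \<Lambda> u : is_umap A B R. \<Lambda> v : is_umap B A (flip A B R).
    umap_cases A B R (\<lambda>u. is_equiv A B (umap_fun A B R u))
      (\<lambda>m g k h. umap_cases B A (flip A B R) (\<lambda>v. is_equiv A B m)
        (\<lambda>n g' k' h'. \<langle>\<langle>n, \<Lambda> b : B. k \<bullet> (n \<bullet> b) \<bullet> b \<bullet> (g' \<bullet> b \<bullet> (n \<bullet> b) \<bullet> rfl (n \<bullet> b))\<rangle>,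
          \<langle>n, \<Lambda> a : A. k' \<bullet> (m \<bullet> a) \<bullet> a \<bullet> (g \<bullet> a \<bullet> (m \<bullet> a) \<bullet> rfl (m \<bullet> a))\<rangle>\<rangle>) v) u"])
    (simp only: surface nat_eval, simp only: nf_eval nat_eval cong: nf_eval_congs)

section \<open>The abstract correspondence between functions and relations\<close>

definition corr_type where [surface]:
  "corr_type L U V = (\<Sigma> R : L. U \<bullet> R \<otimes> V \<bullet> R)"

definition corr_map where [surface]:
  "corr_map M W G a b e = (
    \<langle>G \<bullet> proj1 M (\<lambda>m. W \<bullet> m) e,
    \<langle>a \<bullet> proj1 M (\<lambda>m. W \<bullet> m) e, b \<bullet> proj1 M (\<lambda>m. W \<bullet> m) e \<bullet> proj2 M (\<lambda>m. W \<bullet> m) e\<rangle>\<rangle>)"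

text \<open>Reads the function back off a correspondence. On the image of \<open>m\<close> it
  computes to \<open>f (G m) (a m)\<close>, so a path of correspondences yields a path of
  functions.\<close>

definition corr_fun where [surface]:
  "corr_fun M L U V f y = (
    sig_rec L (\<lambda>R. U \<bullet> R \<otimes> V \<bullet> R) (\<lambda>y. M)
    (\<lambda>R s. sig_rec (U \<bullet> R) (\<lambda>u. V \<bullet> R) (\<lambda>s. M) (\<lambda>u v. f \<bullet> R \<bullet> u) s) y)"

text \<open>
  The theorem with functions \<open>M\<close>, relations \<open>L\<close> and the predicates ``is
  an equivalence'' \<open>W\<close>, ``is a univalent map'' \<open>U\<close> and ``has a univalent
  converse'' \<open>V\<close> abstracted: \<open>G\<close> is the graph of a function and
  \<open>f\<close> the function of a univalent map.
\<close>

definition correspondence :: "nat \<Rightarrow> sc" where [surface]: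
  "correspondence i = (
    \<Pi> M : univ (Suc i). \<Pi> L : univ (Suc i). \<Pi> G : (M \<rightharpoonup> L).
    \<Pi> U : (L \<rightharpoonup> univ (Suc i)). \<Pi> f : (\<Pi> R : L. U \<bullet> R \<rightharpoonup> M). \<Pi> a : (\<Pi> m : M. U \<bullet> (G \<bullet> m)).
    (\<Pi> m : M. path M (f \<bullet> (G \<bullet> m) \<bullet> (a \<bullet> m)) m) \<rightharpoonup>
    (\<Pi> R : L. \<Pi> u : U \<bullet> R. path L (G \<bullet> (f \<bullet> R \<bullet> u)) R) \<rightharpoonup> (\<Pi> R : L. is_prop (U \<bullet> R)) \<rightharpoonup>
    \<Pi> W : (M \<rightharpoonup> univ (Suc i)). (\<Pi> m : M. is_prop (W \<bullet> m)) \<rightharpoonup>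
    \<Pi> V : (L \<rightharpoonup> univ (Suc i)). (\<Pi> R : L. is_prop (V \<bullet> R)) \<rightharpoonup>
    (\<Pi> m : M. W \<bullet> m \<rightharpoonup> V \<bullet> (G \<bullet> m)) \<rightharpoonup> (\<Pi> R : L. \<Pi> u : U \<bullet> R. V \<bullet> R \<rightharpoonup> W \<bullet> (f \<bullet> R \<bullet> u)) \<rightharpoonup>
    eqv (\<Sigma> m : M. W \<bullet> m) (corr_type L U V))"

text \<open>Surjectivity: \<open>R\<close> with \<open>u\<close> and \<open>v\<close> comes from
  \<open>f R u\<close>, whose graph is \<open>R\<close> up to a path, and the remaining components
  are propositions. Injectivity: \<open>corr_fun\<close> and the round trip \<open>fl\<close> turn a
  path of images into a path from \<open>m\<close> to \<open>n\<close>, which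
  \<open>subtype_path\<close> lifts to the pairs.\<close>

lemma inhabited_correspondence: "inhabited (correspondence i)"
proof (rule inhabited_mp[OF _ inhabited_path_euclid],
    rule inhabited_mp[OF _ inhabited_product_prop],
    rule inhabited_mp[OF _ inhabited_bijection_equiv],
    rule inhabited_mp[OF _ inhabited_subtype_path])
  show "inhabited (
    subtype_path i \<rightharpoonup>
    bijection_equiv i \<rightharpoonup>
    product_prop i \<rightharpoonup>
    path_euclid i \<rightharpoonup>
    correspondence i)"
    by (rule inhabited_check[where t = "
      \<Lambda> S : subtype_path i. \<Lambda> K : bijection_equiv i.
      \<Lambda> D : product_prop i. \<Lambda> E : path_euclid i.
      \<Lambda> M : univ (Suc i). \<Lambda> L : univ (Suc i). \<Lambda> G : (M \<rightharpoonup> L).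
      \<Lambda> U : (L \<rightharpoonup> univ (Suc i)). \<Lambda> f : (\<Pi> R : L. U \<bullet> R \<rightharpoonup> M). \<Lambda> a : (\<Pi> m : M. U \<bullet> (G \<bullet> m)).
      \<Lambda> fl : (\<Pi> m : M. path M (f \<bullet> (G \<bullet> m) \<bullet> (a \<bullet> m)) m).
      \<Lambda> rep : (\<Pi> R : L. \<Pi> u : U \<bullet> R. path L (G \<bullet> (f \<bullet> R \<bullet> u)) R). \<Lambda> pu : (\<Pi> R : L. is_prop (U \<bullet> R)).
      \<Lambda> W : (M \<rightharpoonup> univ (Suc i)). \<Lambda> pw : (\<Pi> m : M. is_prop (W \<bullet> m)).
      \<Lambda> V : (L \<rightharpoonup> univ (Suc i)). \<Lambda> pv : (\<Pi> R : L. is_prop (V \<bullet> R)).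
      \<Lambda> b : (\<Pi> m : M. W \<bullet> m \<rightharpoonup> V \<bullet> (G \<bullet> m)).
      \<Lambda> w : (\<Pi> R : L. \<Pi> u : U \<bullet> R. V \<bullet> R \<rightharpoonup> W \<bullet> (f \<bullet> R \<bullet> u)).
      K \<bullet> (\<Sigma> m : M. W \<bullet> m) \<bullet> corr_type L U V \<bullet> (\<Lambda> e : (\<Sigma> m : M. W \<bullet> m). corr_map M W G a b e)
        \<bullet> (\<Lambda> y : corr_type L U V.
            sig_rec L (\<lambda>R. U \<bullet> R \<otimes> V \<bullet> R)
              (\<lambda>y. \<Sigma> e : (\<Sigma> m : M. W \<bullet> m). path (corr_type L U V) (corr_map M W G a b e) y)
              (\<lambda>R s. sig_rec (U \<bullet> R) (\<lambda>u. V \<bullet> R)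
                (\<lambda>s. \<Sigma> e : (\<Sigma> m : M. W \<bullet> m). path (corr_type L U V) (corr_map M W G a b e) \<langle>R, s\<rangle>)
                (\<lambda>u v. \<langle>\<langle>f \<bullet> R \<bullet> u, w \<bullet> R \<bullet> u \<bullet> v\<rangle>,
                  S \<bullet> L \<bullet> (\<Lambda> R : L. U \<bullet> R \<otimes> V \<bullet> R)
                    \<bullet> (\<Lambda> R : L. D \<bullet> (U \<bullet> R) \<bullet> (V \<bullet> R) \<bullet> (pu \<bullet> R) \<bullet> (pv \<bullet> R)) \<bullet> (G \<bullet> (f \<bullet> R \<bullet> u))
                    \<bullet> \<langle>a \<bullet> (f \<bullet> R \<bullet> u), b \<bullet> (f \<bullet> R \<bullet> u) \<bullet> (w \<bullet> R \<bullet> u \<bullet> v)\<rangle>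
                    \<bullet> R \<bullet> (rep \<bullet> R \<bullet> u) \<bullet> \<langle>u, v\<rangle>\<rangle>) s) y)
        \<bullet> (\<Lambda> d : (\<Sigma> m : M. W \<bullet> m).
            sig_rec M (\<lambda>m. W \<bullet> m)
              (\<lambda>d. \<Pi> e : (\<Sigma> m : M. W \<bullet> m).
                path (corr_type L U V) (corr_map M W G a b d) (corr_map M W G a b e) \<rightharpoonup>
                path (\<Sigma> m : M. W \<bullet> m) d e)
              (\<lambda>m x. \<Lambda> e : (\<Sigma> m : M. W \<bullet> m).
                sig_rec M (\<lambda>m. W \<bullet> m)
                  (\<lambda>e. path (corr_type L U V) (corr_map M W G a b \<langle>m, x\<rangle>) (corr_map M W G a b e) \<rightharpoonup>
                    path (\<Sigma> m : M. W \<bullet> m) \<langle>m, x\<rangle> e)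
                  (\<lambda>n y. \<Lambda> p : path (corr_type L U V) \<langle>G \<bullet> m, \<langle>a \<bullet> m, b \<bullet> m \<bullet> x\<rangle>\<rangle> \<langle>G \<bullet> n, \<langle>a \<bullet> n, b \<bullet> n \<bullet> y\<rangle>\<rangle>.
                    S \<bullet> M \<bullet> W \<bullet> pw \<bullet> m \<bullet> x \<bullet> n
                      \<bullet> (E \<bullet> M \<bullet> (f \<bullet> (G \<bullet> m) \<bullet> (a \<bullet> m)) \<bullet> m \<bullet> n \<bullet> (fl \<bullet> m)
                        \<bullet> (path_rec (corr_type L U V)
                            (\<lambda>y z p. path M (corr_fun M L U V f z) n \<rightharpoonup> path M (corr_fun M L U V f y) n)
                            (\<lambda>y. \<Lambda> r : path M (corr_fun M L U V f y) n. r)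
                            \<langle>G \<bullet> m, \<langle>a \<bullet> m, b \<bullet> m \<bullet> x\<rangle>\<rangle> \<langle>G \<bullet> n, \<langle>a \<bullet> n, b \<bullet> n \<bullet> y\<rangle>\<rangle> p \<bullet> (fl \<bullet> n)))
                      \<bullet> y) e) d)"])
      (simp only: surface nat_eval, simp only: nf_eval nat_eval cong: nf_eval_congs)
qed

definition equiv_umap_rel :: "nat \<Rightarrow> sc" where [surface]:
  "equiv_umap_rel i = (\<Pi> A : univ i. \<Pi> B : univ i. eqv (eqv A B) (umap_rel i A B))"

text \<open>The round trip hypothesis of \<open>correspondence\<close> holds by \<open>rfl\<close>,
  as the function of \<open>graph_umap\<close> computes to the given one. After instantiation the
  two sides normalise to those of \<open>Equiv A B\<close> and \<open>UMapRel i A B\<close>.\<close>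

lemma inhabited_equiv_umap_rel: "inhabited (equiv_umap_rel i)"
proof (rule inhabited_mp[OF _ inhabited_umap_is_graph],
    rule inhabited_mp[OF _ inhabited_umap_pair_equiv],
    rule inhabited_mp[OF _ inhabited_converse_graph_umap],
    rule inhabited_mp[OF _ inhabited_is_umap_prop],
    rule inhabited_mp[OF _ inhabited_is_equiv_prop],
    rule inhabited_mp[OF _ inhabited_correspondence])
  show "inhabited (
    correspondence i \<rightharpoonup>
    is_equiv_prop i \<rightharpoonup>
    is_umap_prop i \<rightharpoonup>
    converse_graph_umap i \<rightharpoonup>
    umap_pair_equiv i \<rightharpoonup>
    umap_is_graph i \<rightharpoonup>
    equiv_umap_rel i)"
    by (rule inhabited_check[where t = "
      \<Lambda> C : correspondence i. \<Lambda> W : is_equiv_prop i.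
      \<Lambda> P : is_umap_prop i. \<Lambda> T : converse_graph_umap i.
      \<Lambda> V : umap_pair_equiv i. \<Lambda> M : umap_is_graph i.
      \<Lambda> A : univ i. \<Lambda> B : univ i.
      C \<bullet> (A \<rightharpoonup> B) \<bullet> (A \<rightharpoonup> B \<rightharpoonup> univ i) \<bullet> (\<Lambda> f : (A \<rightharpoonup> B). graph_rel A B f)
        \<bullet> (\<Lambda> R : (A \<rightharpoonup> B \<rightharpoonup> univ i). is_umap A B R)
        \<bullet> (\<Lambda> R : (A \<rightharpoonup> B \<rightharpoonup> univ i). \<Lambda> u : is_umap A B R. umap_fun A B R u)
        \<bullet> (\<Lambda> f : (A \<rightharpoonup> B). graph_umap A B f) \<bullet> (\<Lambda> f : (A \<rightharpoonup> B). rfl f) \<bullet> (M \<bullet> A \<bullet> B) \<bullet> (P \<bullet> A \<bullet> B)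
        \<bullet> (\<Lambda> f : (A \<rightharpoonup> B). is_equiv A B f) \<bullet> (W \<bullet> A \<bullet> B)
        \<bullet> (\<Lambda> R : (A \<rightharpoonup> B \<rightharpoonup> univ i). is_umap B A (flip A B R))
        \<bullet> (\<Lambda> R : (A \<rightharpoonup> B \<rightharpoonup> univ i). P \<bullet> B \<bullet> A \<bullet> flip A B R) \<bullet> (T \<bullet> A \<bullet> B) \<bullet> (V \<bullet> A \<bullet> B)"])
      (simp only: surface nat_eval, simp only: nf_eval nat_eval cong: nf_eval_congs)
qed

theorem theorem3:
  fixes i :: nat
  shows "\<exists>t. [] \<turnstile> t \<^bold>: PiT (Univ i) (PiT (Univ i)
    (Equiv (Equiv (Var 1) (Var 0)) (UMapRel i (Var 1) (Var 0))))"
  using inhabited_equiv_umap_rel[of i]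
  by (simp add: inhabited_def equiv_umap_rel_def pi_type_def bind1_def var_def univ_def eqv_def umap_rel_def)

end
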